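(* Let $n,d,r$ be positive integers. There exists an open and dense semi-algebraic set $\mathcal{U}_5$ in $\mathbb{R}^{r\times n(d)}$ such that for any $u\in\mathcal{U}_5$ and any $f\in\mathcal{C}(F(x,u))$: there exist constants $c>0$ and $R>0$ such that $\mathfrak{m}^{\circ}_f(x)\ge c$ for any $x\in\mathbb{R}^n$ with $\|x\|\ge R$; and if $f$ is bounded from below on $\mathbb{R}^n$, then there exist constants $\tilde{c}>0$ and $\widetilde{R}>0$ such that $f(x)\ge\tilde{c}\|x\|$ for any $x\in\mathbb{R}^n$ with $\|x\|\ge\widetilde{R}$. In particular, in the latter case $f$ is coercive on $\mathbb{R}^n$.
   Context: Let $n(d):=\#\{\alpha\in\mathbb{N}^n : |\alpha|\le d\}$, where $|\alpha|=\alpha_1+\cdots+\alpha_n$. For $u=(u^{(1)},\ldots,u^{(r)})\in\mathbb{R}^{r\times n(d)}$ with $u^{(i)}=(u^{(i)}_\alpha)_{|\alpha|\le d}\in\mathbb{R}^{n(d)}$, put $f_i(x,u^{(i)})=\sum_{|\alpha|\le d}u^{(i)}_\alpha x^\alpha$, a polynomial in $x\in\mathbb{R}^n$ of degree at most $d$, and $F(x,u)=(f_1(x,u^{(1)}),\ldots,f_r(x,u^{(r)}))$. $\mathcal{C}(F(x,u))$ is the set of all continuous selections of these polynomials, i.e. all continuous functions $f\colon\mathbb{R}^n\to\mathbb{R}$ with $f(x)\in\{f_1(x,u^{(1)}),\ldots,f_r(x,u^{(r)})\}$ for every $x\in\mathbb{R}^n$; such functions are locally Lipschitz. For a locally Lipschitz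 $f$, $f^0(\bar x;v)=\limsup_{x\to\bar x,\,t\downarrow0}\frac{f(x+tv)-f(x)}{t}$ and the Clarke subdifferential is $\partial^\circ f(\bar x)=\{\zeta\in\mathbb{R}^n : \langle\zeta,v\rangle\le f^0(\bar x;v)\ \forall v\in\mathbb{R}^n\}$. The non-smooth slope of $f$ at $x$ is $\mathfrak{m}^\circ_f(x)=\inf\{\|\zeta\| : \zeta\in\partial^\circ f(x)\}$ (Euclidean norm). Coercive means $f(x)\to+\infty$ as $\|x\|\to\infty$. *)

theory Defs
  imports "HOL-Analysis.Analysis"
begin

text \<open>
  Coordinates of \<open>\<real>\<^sup>I\<close>, for a finite index set \<open>I\<close>, are given by functions in
  \<open>I \<rightarrow>\<^sub>E UNIV\<close>, with the topology \<open>powertop_real I\<close>.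
\<close>

definition monomial_fun :: "'i set \<Rightarrow> ('i \<Rightarrow> nat) \<Rightarrow> ('i \<Rightarrow> real) \<Rightarrow> real" where
  "monomial_fun I m x = (\<Prod>i\<in>I. x i ^ m i)"

definition polynomial_funs :: "'i set \<Rightarrow> (('i \<Rightarrow> real) \<Rightarrow> real) set" where
  "polynomial_funs I =
     {p. \<exists>M a. finite M \<and> p = (\<lambda>x. \<Sum>m\<in>M. a m * monomial_fun I m x)}"

definition basic_semialgebraic :: "'i set \<Rightarrow> ('i \<Rightarrow> real) set \<Rightarrow> bool" where
  "basic_semialgebraic I S \<longleftrightarrow>
     (\<exists>P Q. finite P \<and> P \<subseteq> polynomial_funs I \<and> finite Q \<and> Q \<subseteq> polynomial_funs I \<and>
        S = {x \<in> I \<rightarrow>\<^sub>E UNIV. (\<forall>p\<in>P. p x = 0) \<and> (\<forall>q\<in>Q. q x > 0)})"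

definition semialgebraic :: "'i set \<Rightarrow> ('i \<Rightarrow> real) set \<Rightarrow> bool" where
  "semialgebraic I S \<longleftrightarrow>
     (\<exists>\<B>. finite \<B> \<and> (\<forall>B\<in>\<B>. basic_semialgebraic I B) \<and> S = \<Union>\<B>)"

definition multi_indices :: "nat \<Rightarrow> ('n::finite \<Rightarrow> nat) set" where
  "multi_indices d = {\<alpha>. (\<Sum>j\<in>UNIV. \<alpha> j) \<le> d}"

text \<open>
  The coefficient \<open>u\<^sup>(\<^sup>i\<^sup>)\<^sub>\<alpha>\<close> is \<open>u (i, \<alpha>)\<close>, so that \<open>\<real>\<^bsup>r \<times> n(d)\<^esup>\<close> is
  \<open>coeff_index r d \<rightarrow>\<^sub>E UNIV\<close>.
\<close>

definition coeff_index :: "nat \<Rightarrow> nat \<Rightarrow> (nat \<times> ('n::finite \<Rightarrow> nat)) set" where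
  "coeff_index r d = {1..r} \<times> multi_indices d"

definition poly_comp ::
    "nat \<Rightarrow> (nat \<times> ('n::finite \<Rightarrow> nat) \<Rightarrow> real) \<Rightarrow> nat \<Rightarrow> real ^ 'n \<Rightarrow> real" where
  "poly_comp d u i x = (\<Sum>\<alpha>\<in>multi_indices d. u (i, \<alpha>) * monomial_fun UNIV \<alpha> (\<lambda>j. x $ j))"

definition cont_selections ::
    "nat \<Rightarrow> nat \<Rightarrow> (nat \<times> ('n::finite \<Rightarrow> nat) \<Rightarrow> real) \<Rightarrow> (real ^ 'n \<Rightarrow> real) set" where
  "cont_selections r d u =
     {f. continuous_on UNIV f \<and> (\<forall>x. f x \<in> (\<lambda>i. poly_comp d u i x) ` {1..r})}"

text \<open>
  The base point \<open>y\<close> ranges over full neighbourhoods of \<open>x\<close>, including \<open>y = x\<close>. Values are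
  extended reals so that the limit superior is meaningful for arbitrary \<open>f\<close>; it is finite
  for locally Lipschitz \<open>f\<close>.
\<close>

definition clarke_dderiv :: "('a::euclidean_space \<Rightarrow> real) \<Rightarrow> 'a \<Rightarrow> 'a \<Rightarrow> ereal" where
  "clarke_dderiv f x v =
     Limsup (nhds x \<times>\<^sub>F at_right 0) (\<lambda>(y, t). ereal ((f (y + t *\<^sub>R v) - f y) / t))"

definition clarke_subdiff :: "('a::euclidean_space \<Rightarrow> real) \<Rightarrow> 'a \<Rightarrow> 'a set" where
  "clarke_subdiff f x = {\<zeta>. \<forall>v. ereal (\<zeta> \<bullet> v) \<le> clarke_dderiv f x v}"

text \<open>
  The infimum is taken in the extended reals; it is finite for locally Lipschitz \<open>f\<close>, whose
  Clarke subdifferential is nonempty everywhere.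
\<close>

definition nonsmooth_slope :: "('a::euclidean_space \<Rightarrow> real) \<Rightarrow> 'a \<Rightarrow> ereal" where
  "nonsmooth_slope f x = (INF \<zeta>\<in>clarke_subdiff f x. ereal (norm \<zeta>))"

definition coercive :: "('a::real_normed_vector \<Rightarrow> real) \<Rightarrow> bool" where
  "coercive f \<longleftrightarrow> filterlim f at_top at_infinity"

end

theory Submission
  imports Defs
begin

text \<open>
  Let \<open>p\<^sub>i\<close> be the homogeneous part of degree \<open>d\<close> of \<open>f\<^sub>i\<close>. If the slope degenerated at
  infinity, rescaling to the unit sphere and Euler's identity would give a point \<open>w \<noteq> 0\<close> and a
  set \<open>I\<close> of indices such that all \<open>p\<^sub>i\<close>, \<open>i \<in> I\<close>, vanish at \<open>w\<close> and their gradients at \<open>w\<close>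
  are linearly dependent. A parameter count shows that the coefficients with this property lie
  in finitely many polynomial images of spaces of smaller dimension, hence in finitely many
  hypersurfaces, and the complement of these is the required set. The slope of a continuous
  selection is bounded below by the least norm of a convex combination of the active gradients;
  linear growth follows by minimising \<open>f\<close> plus a small multiple of the distance to a point.
\<close>

section \<open>Polynomials of bounded box degree and algebraic dependence\<close>

text \<open>The obstacle is to get hypersurfaces out of an existential condition. For fixed
  \<open>I\<close> there is one vanishing equation per index and, since Euler's identity makes one
  component redundant, n - 1 gradient equations. After normalising \<open>w $ j = 1\<close> and
  \<open>\<mu> i0 = 1\<close> there are n - 1 free parameters in \<open>w\<close> and one less than
  the size of \<open>I\<close> in \<open>\<mu>\<close>: one fewer than the equations. These can be
  solved for distinct coefficients without division, so the bad coefficients lie in an explicit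
  polynomial image, and counting monomials yields a polynomial relation on it. The good set is then
  cut out by finitely many conditions \<open>p u \<noteq> 0\<close>, which are open, dense and
  semi-algebraic. The forms in \<open>I\<close> vanish at \<open>w\<close> because active pieces
  agree: pairing \<open>w\<close> with a vanishing convex combination of gradients leaves d times
  the common value. Undoing the rescaling multiplies gradients by \<open>norm x ^ (d - 1)\<close>,
  which is at least 1 for \<open>norm x \<ge> 1\<close>, so the slope bound does not decay.\<close>

lemma homogeneous_system_nontrivial:
  fixes c :: "'x \<Rightarrow> 'e \<Rightarrow> real"
  assumes "finite E" "finite X" "card E < card X"
  shows "\<exists>a. (\<exists>x\<in>X. a x \<noteq> 0) \<and> (\<forall>e\<in>E. (\<Sum>x\<in>X. a x * c x e) = 0)"
  using assms
proof (induction E arbitrary: X c rule: finite_induct)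
  case empty
  then have "X \<noteq> {}" by auto
  then show ?case by (intro exI[of _ "\<lambda>_. 1"]) auto
next
  case (insert e E)
  show ?case
  proof (cases "\<forall>x\<in>X. c x e = 0")
    case True
    have "card E < card X" using insert by simp
    from insert.IH[OF insert.prems(1) this, of c] True show ?thesis by auto
  next
    case False
    then obtain x0 where x0: "x0 \<in> X" "c x0 e \<noteq> 0" by auto
    \<comment> \<open>Gaussian elimination: the unknown \<open>x0\<close> is solved from equation
      \<open>e\<close> and substituted into the remaining ones.\<close>
    define c' where "c' x e' = c x e' - c x e / c x0 e * c x0 e'" for x e'
    have "card E < card (X - {x0})" using insert x0 by simp
    from insert.IH[OF _ this, of c'] insert.prems(1)
    obtain b where b: "\<exists>x\<in>X - {x0}. b x \<noteq> 0" "\<forall>e'\<in>E. (\<Sum>x\<in>X - {x0}. b x * c' x e') = 0"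
      by auto
    define a where "a = b(x0 := - (\<Sum>x\<in>X - {x0}. b x * c x e) / c x0 e)"
    have split: "(\<Sum>x\<in>X. a x * c x e') = a x0 * c x0 e' + (\<Sum>x\<in>X - {x0}. b x * c x e')" for e'
      by (subst sum.remove[OF insert.prems(1) x0(1)]) (auto simp: a_def intro!: sum.cong)
    have eq: "(\<Sum>x\<in>X. a x * c x e') = (\<Sum>x\<in>X - {x0}. b x * c' x e')" for e'
      unfolding split c'_def
      by (simp add: a_def algebra_simps sum_subtractf sum_divide_distrib sum_distrib_left)
    have "(\<Sum>x\<in>X. a x * c x e) = 0" unfolding eq c'_def using x0 by simp
    moreover have "\<exists>x\<in>X. a x \<noteq> 0" using b(1) by (auto simp: a_def)
    ultimately show ?thesis using b(2) eq by auto
  qed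
qed

text \<open>The degree is bounded in each variable separately, so the exponents form a full product
  and can be counted by \<open>card_PiE\<close>; extensionality gives each monomial a single
  index.\<close>

definition box_polys :: "'i set \<Rightarrow> nat \<Rightarrow> (('i \<Rightarrow> real) \<Rightarrow> real) set" where
  "box_polys I e = {p. \<exists>a. p = (\<lambda>x. \<Sum>m\<in>I \<rightarrow>\<^sub>E {..e}. a m * monomial_fun I m x)}"

lemma box_polysI: "(\<And>x. p x = (\<Sum>m\<in>I \<rightarrow>\<^sub>E {..e}. a m * monomial_fun I m x)) \<Longrightarrow> p \<in> box_polys I e"
  unfolding box_polys_def mem_Collect_eq by (intro exI ext) assumption

lemma box_polys_subset_polynomial_funs: "finite I \<Longrightarrow> box_polys I e \<subseteq> polynomial_funs I"
proof
  fix p assume I: "finite I" and "p \<in> box_polys I e"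
  then obtain a where "p = (\<lambda>x. \<Sum>m\<in>I \<rightarrow>\<^sub>E {..e}. a m * monomial_fun I m x)"
    unfolding box_polys_def by auto
  moreover have "finite (I \<rightarrow>\<^sub>E {..e})" using I by (intro finite_PiE) auto
  ultimately show "p \<in> polynomial_funs I"
    unfolding polynomial_funs_def mem_Collect_eq by (intro exI conjI)
qed

lemma box_polys_monomial:
  assumes "finite I" "\<And>i. i \<in> I \<Longrightarrow> m i \<le> e"
  shows "(\<lambda>x. c * monomial_fun I m x) \<in> box_polys I e"
proof (rule box_polysI)
  fix x
  have "(\<Sum>m'\<in>I \<rightarrow>\<^sub>E {..e}. (if m' = restrict m I then c else 0) * monomial_fun I m' x)
      = (\<Sum>m'\<in>I \<rightarrow>\<^sub>E {..e}. if m' = restrict m I then c * monomial_fun I m' x else 0)"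
    by (rule sum.cong) simp_all
  also have "\<dots> = c * monomial_fun I (restrict m I) x"
    using assms by (subst sum.delta) (auto intro!: finite_PiE)
  also have "\<dots> = c * monomial_fun I m x"
    by (simp add: monomial_fun_def)
  finally show "c * monomial_fun I m x
      = (\<Sum>m'\<in>I \<rightarrow>\<^sub>E {..e}. (if m' = restrict m I then c else 0) * monomial_fun I m' x)" ..
qed

lemma box_polys_add:
  assumes "p \<in> box_polys I e" "q \<in> box_polys I e"
  shows "(\<lambda>x. p x + q x) \<in> box_polys I e"
proof -
  from assms obtain a b where
    "p = (\<lambda>x. \<Sum>m\<in>I \<rightarrow>\<^sub>E {..e}. a m * monomial_fun I m x)"
    "q = (\<lambda>x. \<Sum>m\<in>I \<rightarrow>\<^sub>E {..e}. b m * monomial_fun I m x)"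
    by (auto simp: box_polys_def)
  then show ?thesis
    by (intro box_polysI[where a = "\<lambda>m. a m + b m"]) (simp add: sum.distrib distrib_right)
qed

lemma box_polys_sum:
  assumes "finite T" "\<And>t. t \<in> T \<Longrightarrow> p t \<in> box_polys I e"
  shows "(\<lambda>x. \<Sum>t\<in>T. p t x) \<in> box_polys I e"
  using assms
proof (induction T rule: finite_induct)
  case empty
  show ?case by (rule box_polysI[where a = "\<lambda>_. 0"]) simp
next
  case (insert t T)
  then show ?case by (simp add: box_polys_add)
qed

lemma box_polys_mono:
  assumes "finite I" "p \<in> box_polys I e" "e \<le> e'"
  shows "p \<in> box_polys I e'"
proof -
  from assms(2) obtain a where p: "p = (\<lambda>x. \<Sum>m\<in>I \<rightarrow>\<^sub>E {..e}. a m * monomial_fun I m x)"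
    unfolding box_polys_def by blast
  show ?thesis unfolding p
  proof (rule box_polys_sum)
    fix m assume "m \<in> I \<rightarrow>\<^sub>E {..e}"
    then have "m i \<le> e" if "i \<in> I" for i using that by (auto dest: PiE_mem)
    then show "(\<lambda>x. a m * monomial_fun I m x) \<in> box_polys I e'"
      using assms(1,3) by (intro box_polys_monomial) (auto intro: order_trans)
  qed (simp add: assms(1) finite_PiE)
qed

lemma box_polys_mult:
  assumes "finite I" "p \<in> box_polys I e" "q \<in> box_polys I e'"
  shows "(\<lambda>x. p x * q x) \<in> box_polys I (e + e')"
proof -
  from assms obtain a b where
    "p = (\<lambda>x. \<Sum>m\<in>I \<rightarrow>\<^sub>E {..e}. a m * monomial_fun I m x)"
    "q = (\<lambda>x. \<Sum>m\<in>I \<rightarrow>\<^sub>E {..e'}. b m * monomial_fun I m x)"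
    by (auto simp: box_polys_def)
  then have eq: "(\<lambda>x. p x * q x) = (\<lambda>x. \<Sum>m\<in>I \<rightarrow>\<^sub>E {..e}. \<Sum>m'\<in>I \<rightarrow>\<^sub>E {..e'}.
      (a m * b m') * monomial_fun I (\<lambda>i. m i + m' i) x)"
    by (auto simp: sum_product monomial_fun_def power_add prod.distrib mult_ac intro!: sum.cong)
  show ?thesis unfolding eq using assms(1)
    by (intro box_polys_sum box_polys_monomial finite_PiE add_mono) (auto dest!: PiE_mem)
qed

lemma box_polys_const: "finite I \<Longrightarrow> (\<lambda>_. c) \<in> box_polys I e"
  using box_polys_monomial[of I "\<lambda>_. 0" e c] by (simp add: monomial_fun_def)

lemma box_polys_power:
  assumes "finite I" "p \<in> box_polys I e"
  shows "(\<lambda>x. p x ^ k) \<in> box_polys I (k * e)"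
proof (induction k)
  case 0
  show ?case using box_polys_const[OF assms(1)] by simp
next
  case (Suc k)
  from box_polys_mult[OF assms(1) assms(2) this] show ?case by simp
qed

lemma box_polys_prod:
  assumes "finite I" "finite T" "\<And>t. t \<in> T \<Longrightarrow> p t \<in> box_polys I e"
  shows "(\<lambda>x. \<Prod>t\<in>T. p t x) \<in> box_polys I (card T * e)"
  using assms(2,3)
proof (induction T rule: finite_induct)
  case empty
  show ?case by (simp add: box_polys_const assms)
next
  case (insert t T)
  then show ?case using box_polys_mult[OF assms(1), of "p t" e "\<lambda>x. \<Prod>t\<in>T. p t x" "card T * e"]
    by simp
qed

lemma monomial_fun_insert_upd:
  assumes "finite I" "j \<notin> I"
  shows "monomial_fun (insert j I) (m(j := k)) x = x j ^ k * monomial_fun I m x"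
proof -
  have "(\<Prod>i\<in>I. x i ^ (m(j := k)) i) = (\<Prod>i\<in>I. x i ^ m i)"
    using assms by (intro prod.cong) auto
  then show ?thesis using assms by (simp add: monomial_fun_def)
qed

lemma monomial_fun_cong:
  "(\<And>i. i \<in> I \<Longrightarrow> x i = y i) \<Longrightarrow> monomial_fun I m x = monomial_fun I m y"
  by (simp add: monomial_fun_def)

text \<open>With the other variables fixed, this is a polynomial in \<open>x j\<close> with
  infinitely many roots, so its coefficients, which are polynomials in fewer variables, vanish.
  Arbitrary infinite sets \<open>S i\<close> are allowed so that open boxes qualify in the density
  argument.\<close>

lemma box_poly_vanishing_coeffs:
  fixes a :: "('i \<Rightarrow> nat) \<Rightarrow> real"
  assumes "finite I" "\<And>i. i \<in> I \<Longrightarrow> infinite (S i)"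
    and "\<And>x. x \<in> Pi\<^sub>E I S \<Longrightarrow> (\<Sum>m\<in>I \<rightarrow>\<^sub>E {..e}. a m * monomial_fun I m x) = 0"
    and "m \<in> I \<rightarrow>\<^sub>E {..e}"
  shows "a m = 0"
  using assms
proof (induction I arbitrary: a m rule: finite_induct)
  case empty
  then show ?case by (simp add: monomial_fun_def)
next
  case (insert j I)
  let ?B = "I \<rightarrow>\<^sub>E {..e}"
  have sum_eq: "(\<Sum>m\<in>insert j I \<rightarrow>\<^sub>E {..e}. a m * monomial_fun (insert j I) m x)
      = (\<Sum>k\<le>e. (\<Sum>g\<in>?B. a (g(j := k)) * monomial_fun I g x) * x j ^ k)" for x
  proof -
    have "(\<Sum>m\<in>insert j I \<rightarrow>\<^sub>E {..e}. a m * monomial_fun (insert j I) m x)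
      = (\<Sum>(k, g)\<in>{..e} \<times> ?B. a (g(j := k)) * monomial_fun (insert j I) (g(j := k)) x)"
      unfolding PiE_insert_eq
      by (subst sum.reindex[OF inj_combinator[OF insert.hyps(2)]]) (simp add: case_prod_unfold)
    also have "\<dots> = (\<Sum>k\<le>e. \<Sum>g\<in>?B. a (g(j := k)) * monomial_fun (insert j I) (g(j := k)) x)"
      by (rule sum.cartesian_product[symmetric])
    finally show ?thesis
      using insert.hyps by (simp add: monomial_fun_insert_upd sum_distrib_right sum_distrib_left mult_ac)
  qed
  have coeff0: "(\<Sum>g\<in>?B. a (g(j := k)) * monomial_fun I g x) = 0" if x: "x \<in> Pi\<^sub>E I S" and k: "k \<le> e" for x k
  proof (rule ccontr)
    assume nz: "\<not> ?thesis"
    have "(\<Sum>k\<le>e. (\<Sum>g\<in>?B. a (g(j := k)) * monomial_fun I g x) * y ^ k) = 0" if y: "y \<in> S j" for y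
    proof -
      have "x(j := y) \<in> Pi\<^sub>E (insert j I) S" using x y by (auto simp: PiE_def extensional_def)
      from insert.prems(2)[OF this]
      have "(\<Sum>k\<le>e. (\<Sum>g\<in>?B. a (g(j := k)) * monomial_fun I g (x(j := y))) * y ^ k) = 0"
        unfolding sum_eq by simp
      moreover have "monomial_fun I g (x(j := y)) = monomial_fun I g x" for g
        using insert.hyps by (intro monomial_fun_cong) auto
      ultimately show ?thesis by simp
    qed
    moreover have "finite {y. (\<Sum>k\<le>e. (\<Sum>g\<in>?B. a (g(j := k)) * monomial_fun I g x) * y ^ k) = 0}"
      unfolding polyfun_finite_roots using nz k by (intro exI[of _ k]) simp
    ultimately have "finite (S j)" by (meson finite_subset mem_Collect_eq subsetI)
    then show False using insert.prems(1) by auto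
  qed
  obtain k g where m: "m = g(j := k)" "k \<le> e" "g \<in> ?B"
    using insert.prems(3) unfolding PiE_insert_eq by auto
  have "a (g(j := k)) = 0"
    by (rule insert.IH[of "\<lambda>g. a (g(j := k))" g]) (use coeff0 m insert.prems(1) in auto)
  then show ?case by (simp only: m(1))
qed

text \<open>Polynomials in \<open>card I\<close> variables of box degree \<open>D\<close> form a space of dimension
  \<open>(D + 1) ^ card I\<close>, which for large \<open>D\<close> exceeds the dimension
  \<open>O (D ^ card K)\<close> of a space containing their pullbacks under \<open>\<phi>\<close>.\<close>

lemma algebraic_dependence:
  fixes \<phi> :: "'i \<Rightarrow> ('k \<Rightarrow> real) \<Rightarrow> real"
  assumes I: "finite I" and K: "finite K" "card K < card I"
    and \<phi>: "\<And>i. i \<in> I \<Longrightarrow> \<exists>e. \<phi> i \<in> box_polys K e"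
  obtains a D where "\<exists>m\<in>I \<rightarrow>\<^sub>E {..D}. a m \<noteq> 0"
    and "\<And>z. (\<Sum>m\<in>I \<rightarrow>\<^sub>E {..D}. a m * monomial_fun I m (\<lambda>i. \<phi> i z)) = 0"
proof -
  from \<phi> obtain e0 where e0: "\<And>i. i \<in> I \<Longrightarrow> \<phi> i \<in> box_polys K (e0 i)" by metis
  define e where "e = (\<Sum>i\<in>I. e0 i)"
  have e: "\<phi> i \<in> box_polys K e" if "i \<in> I" for i
    by (rule box_polys_mono[OF K(1) e0[OF that]]) (auto simp: I that e_def intro!: member_le_sum)
  define N where "N = card I"
  \<comment> \<open>The pullbacks have box degree at most \<open>E = N * (D * e)\<close>, and
    \<open>b\<close> is chosen with \<open>E + 1 \<le> (D + 1) * b\<close> and \<open>b > 1\<close>.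
    The count then needs \<open>b ^ (N - 1) < D + 1\<close>, which \<open>D + 1 = b ^ N\<close>
    ensures.\<close>
  define b where "b = N * e + 2"
  define D where "D = b ^ N - 1"
  have D1: "D + 1 = b ^ N" by (simp add: D_def b_def)
  define E where "E = N * (D * e)"
  have mon: "(\<lambda>z. monomial_fun I m (\<lambda>i. \<phi> i z)) \<in> box_polys K E" if "m \<in> I \<rightarrow>\<^sub>E {..D}" for m
    unfolding monomial_fun_def E_def N_def
  proof (rule box_polys_prod[OF K(1) I])
    fix i assume "i \<in> I"
    then show "(\<lambda>z. \<phi> i z ^ m i) \<in> box_polys K (D * e)"
      using that by (intro box_polys_mono[OF K(1) box_polys_power[OF K(1) e]] mult_right_mono) auto
  qed
  then have "\<exists>c. \<forall>m\<in>I \<rightarrow>\<^sub>E {..D}. \<forall>z. monomial_fun I m (\<lambda>i. \<phi> i z)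
      = (\<Sum>k\<in>K \<rightarrow>\<^sub>E {..E}. c m k * monomial_fun K k z)"
    unfolding box_polys_def by (simp add: fun_eq_iff) metis
  then obtain c where c: "\<And>m z. m \<in> I \<rightarrow>\<^sub>E {..D} \<Longrightarrow> monomial_fun I m (\<lambda>i. \<phi> i z)
      = (\<Sum>k\<in>K \<rightarrow>\<^sub>E {..E}. c m k * monomial_fun K k z)"
    by blast
  have "card (K \<rightarrow>\<^sub>E {..E}) < card (I \<rightarrow>\<^sub>E {..D})"
  proof -
    have "N > 0" using K by (simp add: N_def)
    have "card (K \<rightarrow>\<^sub>E {..E}) = (E + 1) ^ card K"
      using K by (simp add: card_PiE)
    also have "\<dots> \<le> (E + 1) ^ (N - 1)"
      using K by (intro power_increasing) (auto simp: N_def)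
    also have "\<dots> \<le> ((D + 1) * b) ^ (N - 1)"
      by (intro power_mono) (auto simp: E_def b_def algebra_simps)
    also have "\<dots> = (D + 1) ^ (N - 1) * b ^ (N - 1)"
      by (simp only: power_mult_distrib)
    also have "\<dots> < (D + 1) ^ (N - 1) * b ^ N"
      using \<open>N > 0\<close> by (intro mult_strict_left_mono power_strict_increasing) (auto simp: b_def)
    also have "\<dots> = (D + 1) ^ N"
      unfolding D1[symmetric] using \<open>N > 0\<close> by (metis power_minus_mult)
    also have "\<dots> = card (I \<rightarrow>\<^sub>E {..D})"
      using I by (simp add: card_PiE N_def)
    finally show ?thesis .
  qed
  \<comment> \<open>The unknowns are the coefficients \<open>a m\<close>; there is one equation for
    each monomial \<open>k\<close> in the variables \<open>K\<close>.\<close>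
  from homogeneous_system_nontrivial[OF _ _ this, of c]
  obtain a where a: "\<exists>m\<in>I \<rightarrow>\<^sub>E {..D}. a m \<noteq> 0"
    "\<And>k. k \<in> K \<rightarrow>\<^sub>E {..E} \<Longrightarrow> (\<Sum>m\<in>I \<rightarrow>\<^sub>E {..D}. a m * c m k) = 0"
    using I K by (auto simp: finite_PiE)
  show thesis
  proof (rule that)
    show "\<exists>m\<in>I \<rightarrow>\<^sub>E {..D}. a m \<noteq> 0" by (rule a)
    fix z
    have "(\<Sum>m\<in>I \<rightarrow>\<^sub>E {..D}. a m * monomial_fun I m (\<lambda>i. \<phi> i z))
        = (\<Sum>m\<in>I \<rightarrow>\<^sub>E {..D}. \<Sum>k\<in>K \<rightarrow>\<^sub>E {..E}. a m * c m k * monomial_fun K k z)"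
      by (intro sum.cong) (simp_all add: c sum_distrib_left mult.assoc)
    also have "\<dots> = (\<Sum>k\<in>K \<rightarrow>\<^sub>E {..E}. (\<Sum>m\<in>I \<rightarrow>\<^sub>E {..D}. a m * c m k) * monomial_fun K k z)"
      by (subst sum.swap) (simp add: sum_distrib_right)
    finally show "(\<Sum>m\<in>I \<rightarrow>\<^sub>E {..D}. a m * monomial_fun I m (\<lambda>i. \<phi> i z)) = 0"
      by (simp add: a(2))
  qed
qed

section \<open>Closure properties of the polynomial functions, with degree bounds hidden\<close>

definition polys :: "'i set \<Rightarrow> (('i \<Rightarrow> real) \<Rightarrow> real) set" where
  "polys I = (\<Union>e. box_polys I e)"

lemma polys_common_degree:
  assumes "finite I" "p \<in> polys I" "q \<in> polys I"
  obtains e where "p \<in> box_polys I e" "q \<in> box_polys I e"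
proof -
  from assms obtain e e' where "p \<in> box_polys I e" "q \<in> box_polys I e'" by (auto simp: polys_def)
  then have "p \<in> box_polys I (max e e')" "q \<in> box_polys I (max e e')"
    using box_polys_mono[OF assms(1)] by (meson max.cobounded1 max.cobounded2)+
  then show thesis by (rule that)
qed

context
  fixes I :: "'i set"
  assumes fin: "finite I"
begin

lemma polys_const: "(\<lambda>_. c) \<in> polys I"
  using box_polys_const[OF fin] by (auto simp: polys_def)

lemma polys_var:
  assumes "i \<in> I"
  shows "(\<lambda>x. x i) \<in> polys I"
proof -
  have "monomial_fun I (\<lambda>k. if k = i then 1 else 0) x = x i" for x
    unfolding monomial_fun_def using assms fin
    by (subst prod.remove[of _ i]) auto
  then have "(\<lambda>x. x i) \<in> box_polys I 1"
    using box_polys_monomial[OF fin, of "\<lambda>k. if k = i then 1 else 0" 1 1] by simp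
  then show ?thesis by (auto simp: polys_def)
qed

lemma polys_add:
  assumes "p \<in> polys I" "q \<in> polys I"
  shows "(\<lambda>x. p x + q x) \<in> polys I"
proof -
  obtain e where "p \<in> box_polys I e" "q \<in> box_polys I e"
    by (rule polys_common_degree[OF fin assms])
  from box_polys_add[OF this] show ?thesis unfolding polys_def by blast
qed

lemma polys_mult:
  assumes "p \<in> polys I" "q \<in> polys I"
  shows "(\<lambda>x. p x * q x) \<in> polys I"
proof -
  obtain e where "p \<in> box_polys I e" "q \<in> box_polys I e"
    by (rule polys_common_degree[OF fin assms])
  from box_polys_mult[OF fin this] show ?thesis unfolding polys_def by blast
qed

lemma polys_uminus: "p \<in> polys I \<Longrightarrow> (\<lambda>x. - p x) \<in> polys I"
  using polys_mult[OF polys_const[of "-1"]] by simp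

lemma polys_diff: "p \<in> polys I \<Longrightarrow> q \<in> polys I \<Longrightarrow> (\<lambda>x. p x - q x) \<in> polys I"
  using polys_add[of p "\<lambda>x. - q x"] polys_uminus[of q] by simp

lemma polys_sum:
  assumes "finite T" "\<And>t. t \<in> T \<Longrightarrow> p t \<in> polys I"
  shows "(\<lambda>x. \<Sum>t\<in>T. p t x) \<in> polys I"
  using assms
proof (induction T rule: finite_induct)
  case empty
  show ?case by (simp add: polys_const)
next
  case (insert t T)
  then have "(\<lambda>x. \<Sum>t\<in>T. p t x) \<in> polys I" "p t \<in> polys I" by simp_all
  with polys_add insert.hyps show ?case by simp
qed

lemma polys_power: "p \<in> polys I \<Longrightarrow> (\<lambda>x. p x ^ k) \<in> polys I"
  by (induction k) (simp_all add: polys_const polys_mult)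

lemma polys_prod:
  assumes "finite T" "\<And>t. t \<in> T \<Longrightarrow> p t \<in> polys I"
  shows "(\<lambda>x. \<Prod>t\<in>T. p t x) \<in> polys I"
  using assms
proof (induction T rule: finite_induct)
  case empty
  show ?case by (simp add: polys_const)
next
  case (insert t T)
  then have "(\<lambda>x. \<Prod>t\<in>T. p t x) \<in> polys I" "p t \<in> polys I" by simp_all
  with polys_mult insert.hyps show ?case by simp
qed

end

lemma polys_subset_polynomial_funs: "finite I \<Longrightarrow> polys I \<subseteq> polynomial_funs I"
  using box_polys_subset_polynomial_funs by (auto simp: polys_def)

section \<open>Degenerate leading forms\<close>

text \<open>This is the partial derivative of the monomial with exponent \<open>\<alpha>\<close> in
  direction \<open>l\<close>. For \<open>\<alpha> l = 0\<close> the truncated exponent is harmless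
  because the leading factor is 0.\<close>

definition monomial_partial :: "'n::finite \<Rightarrow> ('n \<Rightarrow> nat) \<Rightarrow> real ^ 'n \<Rightarrow> real" where
  "monomial_partial l \<alpha> x = real (\<alpha> l) * x $ l ^ (\<alpha> l - 1) * (\<Prod>k\<in>UNIV - {l}. x $ k ^ \<alpha> k)"

definition poly_grad ::
    "nat \<Rightarrow> (nat \<times> ('n::finite \<Rightarrow> nat) \<Rightarrow> real) \<Rightarrow> nat \<Rightarrow> real ^ 'n \<Rightarrow> real ^ 'n" where
  "poly_grad d u i x = (\<chi> l. \<Sum>\<alpha>\<in>multi_indices d. u (i, \<alpha>) * monomial_partial l \<alpha> x)"

text \<open>\<open>poly_comp d (rescale d \<tau> u) i w = \<tau> ^ d * poly_comp d u i (w / \<tau>)\<close> for \<open>\<tau> > 0\<close>; at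
  \<open>\<tau> = 0\<close> only the homogeneous part of degree \<open>d\<close> is left, because \<open>0 ^ 0 = 1\<close>.\<close>

definition rescale ::
    "nat \<Rightarrow> real \<Rightarrow> (nat \<times> ('n::finite \<Rightarrow> nat) \<Rightarrow> real) \<Rightarrow> nat \<times> ('n \<Rightarrow> nat) \<Rightarrow> real" where
  "rescale d \<tau> u = (\<lambda>(i, \<alpha>). \<tau> ^ (d - (\<Sum>j\<in>UNIV. \<alpha> j)) * u (i, \<alpha>))"

lemma finite_multi_indices: "finite (multi_indices d :: ('n::finite \<Rightarrow> nat) set)"
proof (rule finite_subset)
  show "multi_indices d \<subseteq> (UNIV \<rightarrow>\<^sub>E {..d} :: ('n \<Rightarrow> nat) set)"
  proof
    fix \<alpha> :: "'n \<Rightarrow> nat" assume "\<alpha> \<in> multi_indices d"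
    then have "(\<Sum>j\<in>UNIV. \<alpha> j) \<le> d" by (simp add: multi_indices_def)
    moreover have "\<alpha> k \<le> (\<Sum>j\<in>UNIV. \<alpha> j)" for k by (rule member_le_sum) simp_all
    ultimately have "\<alpha> k \<le> d" for k using order_trans by blast
    then show "\<alpha> \<in> UNIV \<rightarrow>\<^sub>E {..d}" by (auto simp: PiE_UNIV_domain)
  qed
qed (auto intro: finite_PiE)

lemma finite_coeff_index: "finite (coeff_index r d :: (nat \<times> ('n::finite \<Rightarrow> nat)) set)"
  by (simp add: coeff_index_def finite_multi_indices)

definition top_indices :: "nat \<Rightarrow> ('n::finite \<Rightarrow> nat) set" where
  "top_indices d = {\<alpha>. (\<Sum>j\<in>UNIV. \<alpha> j) = d}"

lemma top_indices_subset: "top_indices d \<subseteq> multi_indices d"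
  by (auto simp: top_indices_def multi_indices_def)

lemma finite_top_indices: "finite (top_indices d :: ('n::finite \<Rightarrow> nat) set)"
  by (rule finite_subset[OF top_indices_subset finite_multi_indices])

lemma sum_rescale_0:
  "(\<Sum>\<alpha>\<in>multi_indices d. rescale d 0 u (i, \<alpha>) * g \<alpha>) = (\<Sum>\<alpha>\<in>top_indices d. u (i, \<alpha>) * g \<alpha>)"
proof -
  have "(\<Sum>\<alpha>\<in>top_indices d. rescale d 0 u (i, \<alpha>) * g \<alpha>)
      = (\<Sum>\<alpha>\<in>multi_indices d. rescale d 0 u (i, \<alpha>) * g \<alpha>)"
    by (rule sum.mono_neutral_left[OF finite_multi_indices top_indices_subset])
      (auto simp: top_indices_def multi_indices_def rescale_def)
  moreover have "(\<Sum>\<alpha>\<in>top_indices d. rescale d 0 u (i, \<alpha>) * g \<alpha>)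
      = (\<Sum>\<alpha>\<in>top_indices d. u (i, \<alpha>) * g \<alpha>)"
    by (rule sum.cong) (auto simp: top_indices_def rescale_def)
  ultimately show ?thesis by simp
qed

text \<open>The exponent of \<open>x\<^sub>j\<^bsup>d-1\<^esup> x\<^sub>l\<close>.\<close>

definition pivot :: "nat \<Rightarrow> 'n \<Rightarrow> 'n \<Rightarrow> 'n::finite \<Rightarrow> nat" where
  "pivot d j l k = (if k = j then d - 1 else 0) + (if k = l then 1 else 0)"

lemma pivot_in_top_indices: "d > 0 \<Longrightarrow> pivot d j l \<in> top_indices d"
  by (simp add: top_indices_def pivot_def sum.distrib)

lemma inj_pivot: "inj (pivot d j)"
proof (rule injI)
  fix l l' assume "pivot d j l = pivot d j l'"
  then have "pivot d j l l = pivot d j l' l" by simp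
  then show "l = l'" by (simp add: pivot_def split: if_splits)
qed

lemma monomial_pivot:
  assumes "w $ j = 1"
  shows "monomial_fun UNIV (pivot d j j) (\<lambda>k. w $ k) = 1"
  unfolding monomial_fun_def by (rule prod.neutral) (use assms in \<open>auto simp: pivot_def\<close>)

text \<open>Where \<open>w $ j = 1\<close>, the partials of the pivot monomials in the directions
  \<open>l \<noteq> j\<close> form an identity matrix. Hence the gradient equations are solved
  without division and the parametrisation stays polynomial.\<close>

lemma monomial_partial_pivot:
  assumes "w $ j = 1" "l \<noteq> j"
  shows "monomial_partial l (pivot d j l') w = (if l' = l then 1 else 0)"
proof -
  have "(\<Prod>k\<in>UNIV - {l}. w $ k ^ pivot d j l k) = 1"
    by (rule prod.neutral) (use assms in \<open>auto simp: pivot_def\<close>)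
  then show ?thesis using assms by (auto simp: monomial_partial_def pivot_def)
qed

text \<open>The equations \<open>p\<^sub>i(w) = 0\<close> determine the coefficients of
  \<open>x\<^sub>j\<^sup>d\<close>, and the \<open>l\<close>-th component of the gradient equation determines the coefficient of
  \<open>x\<^sub>j\<^bsup>d-1\<^esup>x\<^sub>l\<close> in \<open>p\<^bsub>i0\<^esub>\<close>. The slots of the eliminated coefficients are reused for
  the parameters \<open>w\<^sub>l\<close> and \<open>\<mu>\<^sub>i\<close>, which leaves one slot empty; hence the set of these \<open>u\<close> is the
  polynomial image of a space of dimension one less.\<close>

lemma degenerate_coeffs_in_hypersurface:
  fixes j :: "'n::finite"
  assumes d: "d > 0" and I: "I \<subseteq> {1..r}" "i0 \<in> I"
  obtains a D where "\<exists>m\<in>coeff_index r d \<rightarrow>\<^sub>E {..D}. a m \<noteq> 0"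
    and "\<And>u w \<mu>. w $ j = 1 \<Longrightarrow> \<mu> i0 = 1 \<Longrightarrow>
      (\<And>i. i \<in> I \<Longrightarrow> poly_comp d (rescale d 0 u) i w = 0) \<Longrightarrow>
      (\<Sum>i\<in>I. \<mu> i *\<^sub>R poly_grad d (rescale d 0 u) i w) = 0 \<Longrightarrow>
      (\<Sum>m\<in>coeff_index r d \<rightarrow>\<^sub>E {..D}. a m * monomial_fun (coeff_index r d :: (nat \<times> ('n \<Rightarrow> nat)) set) m u) = 0"
proof -
  define A where "A = (coeff_index r d :: (nat \<times> ('n \<Rightarrow> nat)) set)"
  define H where "H = (top_indices d :: ('n \<Rightarrow> nat) set)"
  define m where "m = pivot d j"
  define M where "M = range m"
  \<comment> \<open>The slot \<open>(i0, m j)\<close> is the empty one: the values it could hold,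
    \<open>w $ j\<close> and \<open>\<mu> i0\<close>, are both normalised to 1.\<close>
  define K where "K = A - {(i0, m j)}"
  define mon where "mon \<beta> w = monomial_fun UNIV \<beta> (\<lambda>k. w $ k)" for \<beta> and w :: "real ^ 'n"
  define W :: "(nat \<times> ('n \<Rightarrow> nat) \<Rightarrow> real) \<Rightarrow> real ^ 'n"
    where "W z = (\<chi> l. if l = j then 1 else z (i0, m l))" for z
  \<comment> \<open>The gradient equation in direction \<open>l\<close>, solved for the coefficient
    of \<open>m l\<close> in the form \<open>i0\<close>, with \<open>z (i, m j)\<close> read as
    \<open>\<mu> i\<close>. For \<open>l \<noteq> j\<close> the omitted monomials have zero partial:
    \<open>m j\<close> in every form, and all pivots other than \<open>m l\<close> in the form
    \<open>i0\<close>.\<close>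
  define g where "g l z = - (\<Sum>i\<in>I - {i0}. z (i, m j) * (\<Sum>\<beta>\<in>H - {m j}. z (i, \<beta>) * monomial_partial l \<beta> (W z)))
      - (\<Sum>\<beta>\<in>H - M. z (i0, \<beta>) * monomial_partial l \<beta> (W z))" for l z
  define c where "c i \<beta> z = (if i = i0 \<and> \<beta> \<in> M then g (inv m \<beta>) z else z (i, \<beta>))" for i \<beta> z
  \<comment> \<open>The coefficient of \<open>m j\<close> comes last: its monomial is 1 at
    \<open>W z\<close>, and the equation for \<open>i0\<close> already involves the coefficients
    recovered by \<open>g\<close>.\<close>
  define \<phi> where "\<phi> = (\<lambda>(i, \<alpha>) z. if i \<in> I \<and> \<alpha> = m j
      then - (\<Sum>\<beta>\<in>H - {m j}. c i \<beta> z * mon \<beta> (W z)) else c i \<alpha> z)"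
  have finA: "finite A" by (simp add: A_def finite_coeff_index)
  then have finK: "finite K" by (simp add: K_def)
  have finH: "finite H" by (simp add: H_def finite_top_indices)
  have finI: "finite I" using I finite_subset by blast
  have injm: "inj m" by (simp add: m_def inj_pivot)
  have MH: "M \<subseteq> H" using d by (auto simp: M_def m_def H_def pivot_in_top_indices)
  have HA: "(i, \<beta>) \<in> A" if "i \<in> {1..r}" "\<beta> \<in> H" for i \<beta>
    using that top_indices_subset by (auto simp: A_def coeff_index_def H_def)
  have mH: "m l \<in> H" for l using MH by (auto simp: M_def)
  have mj: "m l = m j \<longleftrightarrow> l = j" for l using injm by (auto dest: injD)
  have cardK: "card K < card A"
    unfolding K_def using finA I mH HA by (intro card_Diff1_less) auto
  have W_poly: "(\<lambda>z. W z $ l) \<in> polys K" for l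
    by (cases "l = j") (use I mH HA mj in \<open>auto simp: W_def K_def intro!: polys_const polys_var finK[unfolded K_def]\<close>)
  have mon_poly: "(\<lambda>z. mon \<beta> (W z)) \<in> polys K" for \<beta>
    unfolding mon_def monomial_fun_def by (intro polys_prod polys_power W_poly finK) auto
  have partial_poly: "(\<lambda>z. monomial_partial l \<beta> (W z)) \<in> polys K" for l \<beta>
    unfolding monomial_partial_def
    by (intro polys_mult polys_const polys_prod polys_power W_poly finK) auto
  have z_poly: "(\<lambda>z. z (i, \<beta>)) \<in> polys K" if "(i, \<beta>) \<in> A" "(i, \<beta>) \<noteq> (i0, m j)" for i \<beta>
    using that by (intro polys_var finK) (auto simp: K_def)
  have g_poly: "g l \<in> polys K" for l
    unfolding g_def[abs_def] using I mH HA M_def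
    by (intro polys_diff polys_uminus polys_sum polys_mult partial_poly z_poly finK finite_Diff finI finH) auto
  have c_poly: "c i \<beta> \<in> polys K" if "(i, \<beta>) \<in> A" "(i, \<beta>) \<noteq> (i0, m j)" for i \<beta>
    using that g_poly z_poly by (cases "i = i0 \<and> \<beta> \<in> M") (auto simp: c_def[abs_def])
  have phi_poly: "\<phi> p \<in> polys K" if "p \<in> A" for p
  proof (cases p)
    case (Pair i \<alpha>)
    show ?thesis
    proof (cases "i \<in> I \<and> \<alpha> = m j")
      case True
      have "(\<lambda>z. - (\<Sum>\<beta>\<in>H - {m j}. c i \<beta> z * mon \<beta> (W z))) \<in> polys K"
        using True I HA by (intro polys_uminus polys_sum polys_mult mon_poly c_poly finK finite_Diff finH) auto
      then show ?thesis using True Pair by (simp add: \<phi>_def)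
    next
      case False
      then have "\<phi> p = c i \<alpha>" using Pair by (auto simp: \<phi>_def)
      then show ?thesis using c_poly[of i \<alpha>] False I that Pair by auto
    qed
  qed
  obtain a D where a: "\<exists>m\<in>A \<rightarrow>\<^sub>E {..D}. a m \<noteq> 0"
    and a0: "\<And>z. (\<Sum>m\<in>A \<rightarrow>\<^sub>E {..D}. a m * monomial_fun A m (\<lambda>i. \<phi> i z)) = 0"
  proof (rule algebraic_dependence[OF finA finK cardK, of \<phi>])
    show "\<exists>e. \<phi> p \<in> box_polys K e" if "p \<in> A" for p
      using phi_poly[OF that] by (simp add: polys_def)
  qed (rule that)
  show thesis
  proof (rule that[of D a])
    show "\<exists>m\<in>coeff_index r d \<rightarrow>\<^sub>E {..D}. a m \<noteq> 0" using a by (simp add: A_def)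
    fix u w \<mu>
    assume w: "w $ j = 1" and \<mu>: "\<mu> i0 = 1"
      and p0: "\<And>i. i \<in> I \<Longrightarrow> poly_comp d (rescale d 0 u) i w = 0"
      and grad0: "(\<Sum>i\<in>I. \<mu> i *\<^sub>R poly_grad d (rescale d 0 u) i w) = 0"
    \<comment> \<open>The preimage of \<open>u\<close> under \<open>\<phi>\<close>: \<open>w\<close>
      and \<open>\<mu>\<close> are written into the reused slots, all other coefficients are
      kept.\<close>
    define z where "z = (\<lambda>(i, \<alpha>). if i = i0 \<and> \<alpha> \<in> M then w $ inv m \<alpha>
        else if i \<in> I \<and> \<alpha> = m j then \<mu> i else u (i, \<alpha>))"
    have invm: "inv m (m l) = l" for l using injm by (rule inv_f_f)
    have mM: "m l \<in> M" for l by (simp add: M_def)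
    have Wz: "W z = w" by (auto simp: W_def z_def vec_eq_iff invm mM w)
    have p0': "(\<Sum>\<beta>\<in>H. u (i, \<beta>) * mon \<beta> w) = 0" if "i \<in> I" for i
      using p0[OF that] unfolding poly_comp_def sum_rescale_0 by (simp add: H_def mon_def)
    have grad0': "(\<Sum>i\<in>I. \<mu> i * (\<Sum>\<beta>\<in>H. u (i, \<beta>) * monomial_partial l \<beta> w)) = 0" for l
      using arg_cong[OF grad0, of "\<lambda>v. v $ l"] unfolding poly_grad_def
      by (simp add: sum_rescale_0 H_def)
    have u_pivot: "g l z = u (i0, m l)" if l: "l \<noteq> j" for l
    proof -
      have part: "monomial_partial l (m l') w = (if l' = l then 1 else 0)" for l'
        unfolding m_def using w l by (rule monomial_partial_pivot)
      have "(\<Sum>\<beta>\<in>M. u (i0, \<beta>) * monomial_partial l \<beta> w) = (\<Sum>l'\<in>UNIV. u (i0, m l') * (if l' = l then 1 else 0))"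
        unfolding M_def by (subst sum.reindex[OF injm]) (simp add: part)
      also have "\<dots> = u (i0, m l)" by (simp add: mult_delta_right)
      finally have M_sum: "(\<Sum>\<beta>\<in>M. u (i0, \<beta>) * monomial_partial l \<beta> w) = u (i0, m l)" .
      have i0_sum: "(\<Sum>\<beta>\<in>H. u (i0, \<beta>) * monomial_partial l \<beta> w)
          = (\<Sum>\<beta>\<in>H - M. u (i0, \<beta>) * monomial_partial l \<beta> w) + u (i0, m l)"
        unfolding M_sum[symmetric] by (rule sum.subset_diff[OF MH finH])
      have i_sum: "(\<Sum>\<beta>\<in>H. u (i, \<beta>) * monomial_partial l \<beta> w)
          = (\<Sum>\<beta>\<in>H - {m j}. u (i, \<beta>) * monomial_partial l \<beta> w)" for i
        using l by (subst sum.remove[OF finH mH[of j]]) (simp add: part)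
      have "(\<Sum>\<beta>\<in>H - M. u (i0, \<beta>) * monomial_partial l \<beta> w) + u (i0, m l)
          + (\<Sum>i\<in>I - {i0}. \<mu> i * (\<Sum>\<beta>\<in>H - {m j}. u (i, \<beta>) * monomial_partial l \<beta> w)) = 0"
        using grad0'[of l] unfolding sum.remove[OF finI I(2)] i0_sum
        unfolding i_sum \<mu> by simp
      moreover have "g l z = - (\<Sum>i\<in>I - {i0}. \<mu> i * (\<Sum>\<beta>\<in>H - {m j}. u (i, \<beta>) * monomial_partial l \<beta> w))
          - (\<Sum>\<beta>\<in>H - M. u (i0, \<beta>) * monomial_partial l \<beta> w)"
        unfolding g_def Wz
        by (intro arg_cong2[of _ _ _ _ "(-)"] arg_cong[of _ _ uminus] sum.cong refl arg_cong2[of _ _ _ _ "(*)"])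
          (auto simp: z_def mM)
      ultimately show ?thesis by simp
    qed
    have c_eq: "c i \<beta> z = u (i, \<beta>)" if "\<beta> \<noteq> m j \<or> i \<notin> I" for i \<beta>
    proof (cases "i = i0 \<and> \<beta> \<in> M")
      case True
      then obtain l where "\<beta> = m l" by (auto simp: M_def)
      then show ?thesis using True that I u_pivot[of l] by (auto simp: c_def invm)
    next
      case False
      then show ?thesis using that by (auto simp: c_def z_def)
    qed
    have "\<phi> (i, \<alpha>) z = u (i, \<alpha>)" for i \<alpha>
    proof (cases "i \<in> I \<and> \<alpha> = m j")
      case True
      have "mon (m j) w = 1" unfolding mon_def m_def using w by (rule monomial_pivot)
      moreover have "u (i, m j) * mon (m j) w + (\<Sum>\<beta>\<in>H - {m j}. u (i, \<beta>) * mon \<beta> w) = 0"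
        using p0'[of i] True sum.remove[OF finH mH[of j], of "\<lambda>\<beta>. u (i, \<beta>) * mon \<beta> w"] by simp
      moreover have "(\<Sum>\<beta>\<in>H - {m j}. c i \<beta> z * mon \<beta> (W z)) = (\<Sum>\<beta>\<in>H - {m j}. u (i, \<beta>) * mon \<beta> w)"
        by (rule sum.cong) (auto simp: c_eq Wz)
      ultimately show ?thesis using True by (simp add: \<phi>_def)
    next
      case False
      then show ?thesis by (auto simp: \<phi>_def c_eq)
    qed
    then have "(\<lambda>p. \<phi> p z) = u" by (auto simp: fun_eq_iff)
    with a0[of z] show "(\<Sum>m\<in>coeff_index r d \<rightarrow>\<^sub>E {..D}. a m * monomial_fun (coeff_index r d) m u) = 0"
      by (simp add: A_def)
  qed
qed

section \<open>Continuous selections of smooth functions\<close>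

text \<open>The selection may switch pieces infinitely often, so the interval cannot be cut into
  finitely many smooth parts. Instead, let \<open>s\<close> be the last point with
  \<open>g s \<le> g a\<close>. Just after \<open>s\<close>, a piece above \<open>g s\<close> is
  inactive by continuity, and any other piece stays below \<open>g a\<close> by monotonicity, so
  \<open>s < b\<close> would contradict the choice of \<open>s\<close>.\<close>

lemma continuous_selection_nonincreasing:
  fixes g :: "real \<Rightarrow> real" and h :: "'i \<Rightarrow> real \<Rightarrow> real"
  assumes J: "finite J" and ab: "a \<le> b"
    and cont_g: "continuous_on UNIV g" and sel: "\<And>s. s \<in> {a..b} \<Longrightarrow> g s \<in> (\<lambda>i. h i s) ` J"
    and cont_h: "\<And>i. i \<in> J \<Longrightarrow> continuous_on UNIV (h i)"
    and mono: "\<And>i s t. i \<in> J \<Longrightarrow> a \<le> s \<Longrightarrow> s \<le> t \<Longrightarrow> t \<le> b \<Longrightarrow> h i t \<le> h i s"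
  shows "g b \<le> g a"
proof -
  define S where "S = {a..b} \<inter> g -` {..g a}"
  have "closed S"
    unfolding S_def
    by (intro continuous_closed_preimage continuous_on_subset[OF cont_g]) auto
  moreover have "a \<in> S" "bdd_above S"
    using ab by (auto simp: S_def intro!: bdd_aboveI[of _ b])
  ultimately have "Sup S \<in> S" using closed_contains_Sup[of S] by blast
  define s where "s = Sup S"
  have s: "a \<le> s" "s \<le> b" "g s \<le> g a"
    using \<open>Sup S \<in> S\<close> by (auto simp: S_def s_def)
  have "s = b"
  proof (rule ccontr)
    assume "s \<noteq> b"
    with s have "s < b" by simp
    have "eventually (\<lambda>t. h i t \<noteq> g t \<or> h i t \<le> g a) (at_right s)" if i: "i \<in> J" for i
    proof (cases "h i s > g s")
      case True
      have "open {t. g t < h i t}"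
        by (rule open_Collect_less[OF cont_g cont_h[OF i]])
      then have "eventually (\<lambda>t. g t < h i t) (nhds s)"
        using eventually_nhds_in_open[of "{t. g t < h i t}" s] True by simp
      then have "eventually (\<lambda>t. g t < h i t) (at_right s)"
        unfolding eventually_at_filter by (rule eventually_mono) simp
      then show ?thesis by (rule eventually_mono) auto
    next
      case False
      have "h i t \<le> g a" if "t \<in> {s<..<b}" for t
        using mono[OF i s(1), of t] False s that by simp
      then show ?thesis
        using \<open>s < b\<close> by (intro eventually_at_rightI[of s b]) auto
    qed
    then have "eventually (\<lambda>t. \<forall>i\<in>J. h i t \<noteq> g t \<or> h i t \<le> g a) (at_right s)"
      using J by (intro eventually_ball_finite ballI)
    moreover have "eventually (\<lambda>t. t \<in> {s<..<b}) (at_right s)"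
      using \<open>s < b\<close> by (intro eventually_at_rightI) auto
    ultimately have "eventually (\<lambda>t. (\<forall>i\<in>J. h i t \<noteq> g t \<or> h i t \<le> g a) \<and> t \<in> {s<..<b}) (at_right s)"
      by (rule eventually_conj)
    then obtain t where t: "\<forall>i\<in>J. h i t \<noteq> g t \<or> h i t \<le> g a" "s < t" "t < b"
      using eventually_happens[of _ "at_right s"] by auto
    have "g t \<le> g a" using sel[of t] t s by auto
    then have "t \<in> S" using t s by (auto simp: S_def)
    then have "t \<le> s" unfolding s_def using \<open>bdd_above S\<close> by (rule cSup_upper)
    with t show False by simp
  qed
  with s show ?thesis by simp
qed

text \<open>Near \<open>x\<close> only pieces active at \<open>x\<close> can be selected, and by
  continuity their gradients still satisfy the strict inequality. Along a short segment these pieces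
  minus \<open>K * s\<close> are therefore nonincreasing, and so is the selection \<open>f\<close>
  minus \<open>K * s\<close>.\<close>

lemma selection_difference_quotient:
  fixes f :: "'a::euclidean_space \<Rightarrow> real" and F :: "'i \<Rightarrow> 'a \<Rightarrow> real"
  assumes J: "finite J" and f: "continuous_on UNIV f" "\<And>x. f x \<in> (\<lambda>i. F i x) ` J"
    and der: "\<And>i x. i \<in> J \<Longrightarrow> (F i has_derivative (\<lambda>h. G i x \<bullet> h)) (at x)"
    and cont: "\<And>i. i \<in> J \<Longrightarrow> continuous_on UNIV (G i)"
    and act: "\<And>i. i \<in> J \<Longrightarrow> F i x = f x \<Longrightarrow> G i x \<bullet> v < K"
  shows "eventually (\<lambda>(y, t). (f (y + t *\<^sub>R v) - f y) / t \<le> K) (nhds x \<times>\<^sub>F at_right 0)"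
proof -
  have contF: "continuous_on UNIV (F i)" if "i \<in> J" for i
    using der[OF that] by (intro differentiable_imp_continuous_on) (auto simp: differentiable_on_def intro: differentiableI)
  define J' where "J' = {i \<in> J. F i x = f x}"
  define good where "good y \<longleftrightarrow> (\<forall>i\<in>J. if F i x = f x then G i y \<bullet> v < K else F i y \<noteq> f y)" for y
  have "eventually good (nhds x)"
    unfolding good_def
  proof (intro eventually_ball_finite[OF J] ballI)
    fix i assume i: "i \<in> J"
    show "eventually (\<lambda>y. if F i x = f x then G i y \<bullet> v < K else F i y \<noteq> f y) (nhds x)"
    proof (cases "F i x = f x")
      case True
      have "open {y. G i y \<bullet> v < K}"
        by (intro open_Collect_less continuous_intros cont i)
      then show ?thesis
        using True act[OF i] eventually_nhds_in_open[of "{y. G i y \<bullet> v < K}" x] by simp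
    next
      case False
      have "open {y. F i y \<noteq> f y}"
        by (intro open_Collect_neq contF i f)
      then show ?thesis
        using False eventually_nhds_in_open[of "{y. F i y \<noteq> f y}" x] by simp
    qed
  qed
  then obtain \<delta> where \<delta>: "\<delta> > 0" "\<And>y. dist y x < \<delta> \<Longrightarrow> good y"
    unfolding eventually_nhds_metric by auto
  \<comment> \<open>Keeps the segment within half of \<open>\<delta>\<close> of its starting point;
    the added 1 covers \<open>v = 0\<close>.\<close>
  define \<epsilon> where "\<epsilon> = \<delta> / 2 / (norm v + 1)"
  have \<epsilon>: "\<epsilon> > 0" using \<delta> by (simp add: \<epsilon>_def add_nonneg_pos)
  have main: "(f (y + t *\<^sub>R v) - f y) / t \<le> K" if y: "dist y x < \<delta> / 2" and t: "0 < t" "t < \<epsilon>" for y t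
  proof -
    have in_ball: "good (y + s *\<^sub>R v)" if s: "s \<in> {0..t}" for s
    proof (rule \<delta>(2))
      have "s * norm v \<le> \<epsilon> * norm v" using s t by (intro mult_right_mono) auto
      also have "\<dots> \<le> \<epsilon> * (norm v + 1)" using \<epsilon> by simp
      also have "\<dots> = \<delta> / 2"
        unfolding \<epsilon>_def using norm_ge_zero[of v]
        by (intro nonzero_eq_divide_eq[THEN iffD1, OF _ refl]) linarith
      finally have "norm (s *\<^sub>R v) \<le> \<delta> / 2" using s by simp
      then show "dist (y + s *\<^sub>R v) x < \<delta>"
        using y norm_triangle_ineq[of "y - x" "s *\<^sub>R v"] by (simp add: dist_norm algebra_simps)
    qed
    define g where "g s = f (y + s *\<^sub>R v) - K * s" for s
    define h where "h i s = F i (y + s *\<^sub>R v) - K * s" for i s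
    have der_h: "(h i has_real_derivative (G i (y + s *\<^sub>R v) \<bullet> v - K)) (at s)" if "i \<in> J" for i s
    proof -
      have "((\<lambda>s. F i (y + s *\<^sub>R v)) has_derivative (\<lambda>r. G i (y + s *\<^sub>R v) \<bullet> (r *\<^sub>R v))) (at s)"
        by (rule has_derivative_compose[OF _ der[OF that]]) (auto intro!: derivative_eq_intros)
      then have "((\<lambda>s. F i (y + s *\<^sub>R v)) has_real_derivative (G i (y + s *\<^sub>R v) \<bullet> v)) (at s)"
        by (simp add: has_field_derivative_def mult_commute_abs)
      then show ?thesis unfolding h_def by (auto intro!: derivative_eq_intros)
    qed
    have "g t \<le> g 0"
    proof (rule continuous_selection_nonincreasing[where J = J' and h = h and g = g and a = 0 and b = t])
      show "finite J'" using J by (simp add: J'_def)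
      show "0 \<le> t" using t by simp
      show "continuous_on UNIV g" unfolding g_def
        by (intro continuous_intros continuous_on_compose2[OF f(1)]) auto
      show "g s \<in> (\<lambda>i. h i s) ` J'" if s: "s \<in> {0..t}" for s
      proof -
        obtain i where i: "i \<in> J" "f (y + s *\<^sub>R v) = F i (y + s *\<^sub>R v)"
          using f(2)[of "y + s *\<^sub>R v"] by blast
        have "F i x = f x"
          using bspec[OF in_ball[OF s, unfolded good_def] i(1)] i(2) by (auto split: if_splits)
        with i(1) have "i \<in> J'" by (simp add: J'_def)
        with i(2) show ?thesis by (auto simp: g_def h_def)
      qed
      show "continuous_on UNIV (h i)" if "i \<in> J'" for i
      proof (rule DERIV_continuous_on)
        show "(h i has_real_derivative (G i (y + s *\<^sub>R v) \<bullet> v - K)) (at s within UNIV)" for s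
          using der_h[of i s] that by (simp add: J'_def)
      qed
      show "h i s' \<le> h i s" if i: "i \<in> J'" and s: "0 \<le> s" "s \<le> s'" "s' \<le> t" for i s s'
      proof (rule DERIV_nonpos_imp_nonincreasing[OF s(2)])
        fix q assume q: "s \<le> q" "q \<le> s'"
        have "G i (y + q *\<^sub>R v) \<bullet> v < K"
          using bspec[OF in_ball[of q, unfolded good_def], of i] i q s by (simp add: J'_def)
        then show "\<exists>D. (h i has_real_derivative D) (at q) \<and> D \<le> 0"
          using der_h[of i q] i by (intro exI[of _ "G i (y + q *\<^sub>R v) \<bullet> v - K"]) (auto simp: J'_def)
      qed
    qed
    then show ?thesis using t by (simp add: g_def field_simps)
  qed
  have "eventually (\<lambda>y. dist y x < \<delta> / 2) (nhds x)"
    unfolding eventually_nhds_metric using \<delta>(1) by (intro exI[of _ "\<delta> / 2"]) auto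
  moreover have "eventually (\<lambda>t. t \<in> {0<..<\<epsilon>}) (at_right 0)"
    using \<epsilon> by (intro eventually_at_rightI) auto
  ultimately show ?thesis
    unfolding eventually_prod_filter using main
    by (intro exI[of _ "\<lambda>y. dist y x < \<delta> / 2"] exI[of _ "\<lambda>t. t \<in> {0<..<\<epsilon>}"]) auto
qed

text \<open>The direction is opposite to the point \<open>z\<close> of least norm in the convex
  hull: the projection inequality gives \<open>g i \<bullet> z \<ge> norm z ^ 2\<close>, and
  \<open>norm z \<ge> c\<close> by hypothesis.\<close>

lemma convex_combinations_separating_direction:
  fixes g :: "'i \<Rightarrow> 'a::euclidean_space"
  assumes I: "finite I" "I \<noteq> {}" and c: "c > 0"
    and bound: "\<And>I' lam. I' \<subseteq> I \<Longrightarrow> (\<And>i. i \<in> I' \<Longrightarrow> 0 \<le> lam i) \<Longrightarrow> sum lam I' = 1 \<Longrightarrow>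
      norm (\<Sum>i\<in>I'. lam i *\<^sub>R g i) \<ge> c"
  obtains v where "norm v = 1" "\<And>i. i \<in> I \<Longrightarrow> g i \<bullet> v \<le> - c"
proof -
  define C where "C = convex hull (g ` I)"
  have C: "convex C" "closed C" "C \<noteq> {}"
    using I by (auto simp: C_def finite_imp_compact_convex_hull compact_imp_closed)
  define z where "z = closest_point C 0"
  have "z \<in> C" unfolding z_def using C by (intro closest_point_in_set)
  \<comment> \<open>Convex hull weights are attached to points, not to indices; restricting to
    \<open>I'\<close>, where \<open>g\<close> is injective, turns them into weights on indices. This
    is why \<open>bound\<close> ranges over subsets.\<close>
  obtain I' where I': "I' \<subseteq> I" "inj_on g I'" "g ` I = g ` I'"
    using subset_image_inj[of "g ` I" g I] by auto
  then have "finite I'" using I finite_subset by blast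
  have "z \<in> convex hull (g ` I')" using \<open>z \<in> C\<close> I' by (simp add: C_def)
  then obtain lam where lam: "\<And>y. y \<in> g ` I' \<Longrightarrow> 0 \<le> lam y" "sum lam (g ` I') = 1"
      "(\<Sum>y\<in>g ` I'. lam y *\<^sub>R y) = z"
    using convex_hull_finite[of "g ` I'"] \<open>finite I'\<close> by auto
  have "norm (\<Sum>i\<in>I'. lam (g i) *\<^sub>R g i) \<ge> c"
    using lam I' by (intro bound) (auto simp: sum.reindex)
  then have z: "norm z \<ge> c"
    using lam(3) I'(2) by (simp add: sum.reindex)
  show thesis
  proof (rule that[of "- (1 / norm z) *\<^sub>R z"])
    show "norm (- (1 / norm z) *\<^sub>R z) = 1" using z c by auto
    fix i assume "i \<in> I"
    then have "g i \<in> C" unfolding C_def by (simp add: hull_inc)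
    then have "(0 - z) \<bullet> (g i - z) \<le> 0"
      unfolding z_def using C by (intro closest_point_dot)
    then have "norm z * norm z \<le> g i \<bullet> z"
      by (simp add: inner_diff_right inner_commute flip: power2_eq_square power2_norm_eq_inner)
    then have "norm z \<le> (g i \<bullet> z) / norm z"
      using order_less_le_trans[OF c z] by (simp add: pos_le_divide_eq)
    then show "g i \<bullet> (- (1 / norm z) *\<^sub>R z) \<le> - c" using z by simp
  qed
qed

text \<open>The hypothesis \<open>bound\<close> speaks of any pieces that agree at \<open>x\<close>,
  whether or not \<open>f\<close> takes their value, so it does not depend on the selection.\<close>

locale selection_with_gradient_bound =
  fixes J :: "'i set" and f :: "'a::euclidean_space \<Rightarrow> real"
    and F :: "'i \<Rightarrow> 'a \<Rightarrow> real" and G :: "'i \<Rightarrow> 'a \<Rightarrow> 'a" and c R :: real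
  assumes J: "finite J" and cont_f: "continuous_on UNIV f" and sel: "\<And>x. f x \<in> (\<lambda>i. F i x) ` J"
    and der: "\<And>i x. i \<in> J \<Longrightarrow> (F i has_derivative (\<lambda>h. G i x \<bullet> h)) (at x)"
    and cont_G: "\<And>i. i \<in> J \<Longrightarrow> continuous_on UNIV (G i)"
    and c: "c > 0"
    and bound: "\<And>x I lam. norm x \<ge> R \<Longrightarrow> I \<subseteq> J \<Longrightarrow> (\<And>i k. i \<in> I \<Longrightarrow> k \<in> I \<Longrightarrow> F i x = F k x) \<Longrightarrow>
      (\<And>i. i \<in> I \<Longrightarrow> 0 \<le> lam i) \<Longrightarrow> sum lam I = 1 \<Longrightarrow> norm (\<Sum>i\<in>I. lam i *\<^sub>R G i x) \<ge> c"
begin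

text \<open>The active gradients have inner product at most \<open>- c\<close> with a suitable
  \<open>v\<close>; the slack \<open>- c < K\<close> supplies the strict inequality that persists
  near \<open>x\<close>.\<close>

lemma descent_direction:
  assumes x: "norm x \<ge> R" and K: "- c < K"
  obtains v where "norm v = 1"
    "eventually (\<lambda>(y, t). (f (y + t *\<^sub>R v) - f y) / t \<le> K) (nhds x \<times>\<^sub>F at_right 0)"
proof -
  define I where "I = {i \<in> J. F i x = f x}"
  have I: "finite I" "I \<noteq> {}" using J sel[of x] by (auto simp: I_def)
  obtain v where v: "norm v = 1" "\<And>i. i \<in> I \<Longrightarrow> G i x \<bullet> v \<le> - c"
  proof (rule convex_combinations_separating_direction[OF I c, of "\<lambda>i. G i x"])
    fix I' and lam :: "'i \<Rightarrow> real"
    assume "I' \<subseteq> I" "\<And>i. i \<in> I' \<Longrightarrow> 0 \<le> lam i" "sum lam I' = 1"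
    then show "c \<le> norm (\<Sum>i\<in>I'. lam i *\<^sub>R G i x)"
      using x by (intro bound) (auto simp: I_def subset_iff)
  qed (rule that)
  show thesis
  proof (rule that[OF v(1)])
    show "eventually (\<lambda>(y, t). (f (y + t *\<^sub>R v) - f y) / t \<le> K) (nhds x \<times>\<^sub>F at_right 0)"
      using v(2) K by (intro selection_difference_quotient[OF J cont_f sel der cont_G]) (force simp: I_def)+
  qed
qed

text \<open>For each \<open>c' < c\<close> there is a unit vector \<open>v\<close> with Clarke
  derivative at most \<open>- c'\<close>. Any subgradient then satisfies
  \<open>\<zeta> \<bullet> v \<le> - c'\<close>, and Cauchy-Schwarz gives
  \<open>norm \<zeta> \<ge> c'\<close>.\<close>

lemma nonsmooth_slope_ge:
  assumes x: "norm x \<ge> R"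
  shows "nonsmooth_slope f x \<ge> ereal c"
  unfolding nonsmooth_slope_def
proof (rule INF_greatest)
  fix \<zeta> assume \<zeta>: "\<zeta> \<in> clarke_subdiff f x"
  have "c' \<le> norm \<zeta>" if "c' < c" for c'
  proof -
    obtain v where v: "norm v = 1"
      "eventually (\<lambda>(y, t). (f (y + t *\<^sub>R v) - f y) / t \<le> - c') (nhds x \<times>\<^sub>F at_right 0)"
      using descent_direction[OF x, of "- c'"] \<open>c' < c\<close> by auto
    have "clarke_dderiv f x v \<le> ereal (- c')"
      unfolding clarke_dderiv_def
      by (rule Limsup_bounded) (use v(2) in \<open>auto elim!: eventually_mono\<close>)
    moreover have "ereal (\<zeta> \<bullet> v) \<le> clarke_dderiv f x v"
      using \<zeta> by (simp add: clarke_subdiff_def)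
    ultimately have "\<zeta> \<bullet> v \<le> - c'" using order_trans by fastforce
    moreover have "\<bar>\<zeta> \<bullet> v\<bar> \<le> norm \<zeta>" using Cauchy_Schwarz_ineq2[of \<zeta> v] v(1) by simp
    ultimately show ?thesis by linarith
  qed
  then have "c \<le> norm \<zeta>" using dense_le by blast
  then show "ereal c \<le> ereal (norm \<zeta>)" by simp
qed

text \<open>A global minimiser \<open>y\<close> of \<open>f + (c / 2) * dist x\<close> has slope at most \<open>c / 2\<close>, hence lies in
  the ball of radius \<open>R\<close>.\<close>

lemma linear_lower_bound:
  assumes m: "\<And>x. m \<le> f x"
  shows "f x \<ge> m + c / 2 * (norm x - R)"
proof -
  define h where "h z = f z + c / 2 * norm (z - x)" for z
  have cont_h: "continuous_on S h" for S
    unfolding h_def by (intro continuous_intros continuous_on_subset[OF cont_f]) auto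
  \<comment> \<open>Chosen so that \<open>m + c / 2 * \<rho> = f x\<close>: outside the ball
    \<open>h\<close> is at least \<open>h x\<close>, so a minimiser on the ball is a global
    one.\<close>
  define \<rho> where "\<rho> = 2 * (f x - m) / c"
  have "\<rho> \<ge> 0" using c m[of x] by (simp add: \<rho>_def)
  then have "\<exists>y\<in>cball x \<rho>. \<forall>z\<in>cball x \<rho>. h y \<le> h z"
    by (intro continuous_attains_inf cont_h) auto
  then obtain y where y: "\<And>z. z \<in> cball x \<rho> \<Longrightarrow> h y \<le> h z" by blast
  have min: "h y \<le> h z" for z
  proof (cases "z \<in> cball x \<rho>")
    case False
    then have "\<rho> < norm (z - x)" by (simp add: dist_norm norm_minus_commute)
    then have "c / 2 * \<rho> \<le> c / 2 * norm (z - x)" using c by simp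
    moreover have "c / 2 * \<rho> = f x - m" using c by (simp add: \<rho>_def)
    ultimately have "h x \<le> h z" using m[of z] by (simp add: h_def)
    moreover have "h y \<le> h x" using y[of x] \<open>\<rho> \<ge> 0\<close> by simp
    ultimately show ?thesis by simp
  qed (rule y)
  have "norm y < R"
  proof (rule ccontr)
    assume "\<not> norm y < R"
    \<comment> \<open>Any rate strictly between \<open>c / 2\<close> and \<open>c\<close> would do:
      the distance term grows at rate at most \<open>c / 2\<close>, so \<open>h\<close> would drop
      by at least \<open>c * t / 4\<close> below its minimum.\<close>
    then obtain v where v: "norm v = 1"
      "eventually (\<lambda>(y, t). (f (y + t *\<^sub>R v) - f y) / t \<le> - (3 / 4 * c)) (nhds y \<times>\<^sub>F at_right 0)"
      using descent_direction[of y "- (3 / 4 * c)"] c by auto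
    then obtain Pf Pg where P: "eventually Pf (nhds y)" "eventually Pg (at_right (0::real))"
      "\<And>z t. Pf z \<Longrightarrow> Pg t \<Longrightarrow> (f (z + t *\<^sub>R v) - f z) / t \<le> - (3 / 4 * c)"
      unfolding eventually_prod_filter by auto
    have "eventually (\<lambda>t. Pg t \<and> 0 < t) (at_right (0::real))"
      using P(2) eventually_at_right_less by (rule eventually_conj)
    then obtain t where t: "Pg t" "t > 0"
      using eventually_happens[of _ "at_right (0::real)"] by auto
    have "(f (y + t *\<^sub>R v) - f y) / t \<le> - (3 / 4 * c)"
      using P(3)[OF eventually_nhds_x_imp_x[OF P(1)] t(1)] .
    then have "f (y + t *\<^sub>R v) - f y \<le> - (3 / 4 * c) * t"
      using t(2) by (simp add: pos_divide_le_eq)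
    moreover have "norm (y + t *\<^sub>R v - x) \<le> norm (y - x) + t"
      using norm_triangle_ineq[of "y - x" "t *\<^sub>R v"] v(1) t(2) by (simp add: algebra_simps)
    then have "c / 2 * norm (y + t *\<^sub>R v - x) \<le> c / 2 * (norm (y - x) + t)"
      using c by simp
    ultimately have "h (y + t *\<^sub>R v) \<le> h y - c * t / 4"
      by (simp add: h_def algebra_simps)
    moreover have "c * t > 0" using c t by simp
    ultimately show False using min[of "y + t *\<^sub>R v"] by simp
  qed
  then have "norm x - R \<le> norm (y - x)"
    using norm_triangle_ineq2[of x y] by (simp add: norm_minus_commute)
  then have "m + c / 2 * (norm x - R) \<le> m + c / 2 * norm (y - x)" using c by simp
  also have "\<dots> \<le> h y" using m[of y] by (simp add: h_def)
  also have "\<dots> \<le> h x" by (rule min)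
  finally show ?thesis by (simp add: h_def)
qed

lemma linear_growth:
  assumes "bdd_below (range f)"
  obtains R' where "R' > 0" "\<And>x. norm x \<ge> R' \<Longrightarrow> f x \<ge> c / 4 * norm x"
proof -
  obtain m where m: "\<And>x. m \<le> f x" using assms by (auto simp: bdd_below_def)
  \<comment> \<open>From this radius on, the difference between the slopes \<open>c / 2\<close> and
    \<open>c / 4\<close> absorbs the constant \<open>m - c / 2 * R\<close>.\<close>
  define R' where "R' = max 1 (4 * (c / 2 * R - m) / c)"
  show thesis
  proof (rule that[of R'])
    show "R' > 0" by (simp add: R'_def)
    fix x :: 'a assume "norm x \<ge> R'"
    then have "4 * (c / 2 * R - m) / c \<le> norm x" by (simp add: R'_def)
    then have "4 * (c / 2 * R - m) \<le> norm x * c" using c by (simp add: pos_divide_le_eq)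
    then have "c / 4 * norm x \<le> m + c / 2 * (norm x - R)" by (simp add: field_simps)
    also have "\<dots> \<le> f x" by (rule linear_lower_bound[OF m])
    finally show "c / 4 * norm x \<le> f x" .
  qed
qed

end

lemma coerciveI_linear:
  assumes "c > 0" "\<And>x. norm x \<ge> R \<Longrightarrow> f x \<ge> c * norm x"
  shows "coercive f"
  unfolding coercive_def filterlim_at_top
proof
  fix Z
  show "eventually (\<lambda>x. Z \<le> f x) at_infinity"
    unfolding eventually_at_infinity
  proof (intro exI allI impI)
    fix x :: 'a assume x: "max R (Z / c) \<le> norm x"
    then have "Z \<le> c * norm x" using assms(1) by (simp add: pos_divide_le_eq mult.commute)
    then show "Z \<le> f x" using assms(2)[of x] x by simp
  qed
qed

section \<open>Complements of hypersurfaces\<close>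

text \<open>Being nonzero is stated through a coefficient, which is what
  \<open>algebraic_dependence\<close> provides; \<open>box_poly_vanishing_coeffs\<close> converts it
  into nonvanishing somewhere on every product of infinite sets.\<close>

definition nonzero_polys :: "'i set \<Rightarrow> (('i \<Rightarrow> real) \<Rightarrow> real) set" where
  "nonzero_polys I = {p. \<exists>a D. (\<exists>m\<in>I \<rightarrow>\<^sub>E {..D}. a m \<noteq> 0) \<and>
     p = (\<lambda>x. \<Sum>m\<in>I \<rightarrow>\<^sub>E {..D}. a m * monomial_fun I m x)}"

lemma nonzero_polys_subset: "nonzero_polys I \<subseteq> polys I"
  unfolding nonzero_polys_def polys_def box_polys_def by auto

lemma openin_nonzero_poly:
  assumes I: "finite I" and p: "p \<in> nonzero_polys I"
  shows "openin (powertop_real I) {x \<in> I \<rightarrow>\<^sub>E UNIV. p x \<noteq> 0}"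
proof -
  obtain a D where p_eq: "p = (\<lambda>x. \<Sum>m\<in>I \<rightarrow>\<^sub>E {..D}. a m * monomial_fun I m x)"
    using p by (auto simp: nonzero_polys_def)
  have "continuous_map (powertop_real I) euclideanreal p"
    unfolding p_eq monomial_fun_def using I
    by (intro continuous_map_sum continuous_map_prod continuous_map_real_mult_left
        continuous_map_real_pow continuous_map_product_projection finite_PiE) auto
  from openin_continuous_map_preimage[OF this, of "- {0}"] show ?thesis
    by (simp add: open_Compl)
qed

text \<open>A nonempty open set contains a nonempty product of open subsets of the line. Its factors
  are infinite, so \<open>p\<close> cannot vanish on all of it.\<close>

lemma dense_nonzero_poly:
  assumes I: "finite I" and p: "p \<in> nonzero_polys I"
  shows "powertop_real I closure_of {x \<in> I \<rightarrow>\<^sub>E UNIV. p x \<noteq> 0} = topspace (powertop_real I)"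
  unfolding dense_intersects_open
proof (intro allI impI, elim conjE)
  fix T assume T: "openin (powertop_real I) T" "T \<noteq> {}"
  obtain a D m where p_eq: "p = (\<lambda>x. \<Sum>m\<in>I \<rightarrow>\<^sub>E {..D}. a m * monomial_fun I m x)"
    and m: "m \<in> I \<rightarrow>\<^sub>E {..D}" "a m \<noteq> 0"
    using p by (auto simp: nonzero_polys_def)
  from T obtain x where "x \<in> T" by auto
  then obtain S where S: "\<And>i. i \<in> I \<Longrightarrow> open (S i)" "x \<in> Pi\<^sub>E I S" "Pi\<^sub>E I S \<subseteq> T"
    using bspec[OF T(1)[unfolded openin_product_topology_alt] \<open>x \<in> T\<close>] by auto
  have "infinite (S i)" if "i \<in> I" for i
    using S(1)[OF that] S(2) that finite_imp_not_open[of "S i"] by (auto simp: PiE_iff)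
  then have "\<not> (\<forall>y\<in>Pi\<^sub>E I S. p y = 0)"
    using box_poly_vanishing_coeffs[OF I, where S = S and e = D and a = a and m = m] m by (auto simp: p_eq)
  then obtain y where y: "y \<in> Pi\<^sub>E I S" "p y \<noteq> 0" by auto
  then have "y \<in> {x \<in> I \<rightarrow>\<^sub>E UNIV. p x \<noteq> 0} \<inter> T"
    using subsetD[OF S(3) y(1)] by (auto simp: PiE_iff)
  then show "{x \<in> I \<rightarrow>\<^sub>E UNIV. p x \<noteq> 0} \<inter> T \<noteq> {}" by blast
qed

text \<open>An open set \<open>W\<close> meets a dense set \<open>V\<close> in a set with the same
  closure as \<open>W\<close>, so open dense sets can be intersected one at a time.\<close>

lemma open_dense_nonzero_polys:
  assumes I: "finite I" and P: "finite P" "P \<subseteq> nonzero_polys I"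
  defines "U \<equiv> {x \<in> I \<rightarrow>\<^sub>E UNIV. \<forall>p\<in>P. p x \<noteq> 0}"
  shows "openin (powertop_real I) U"
    and "powertop_real I closure_of U = topspace (powertop_real I)"
proof -
  have "openin (powertop_real I) {x \<in> I \<rightarrow>\<^sub>E UNIV. \<forall>p\<in>P. p x \<noteq> 0} \<and>
      powertop_real I closure_of {x \<in> I \<rightarrow>\<^sub>E UNIV. \<forall>p\<in>P. p x \<noteq> 0} = topspace (powertop_real I)"
    using P
  proof (induction P rule: finite_induct)
    case empty
    have "{x \<in> I \<rightarrow>\<^sub>E UNIV. \<forall>p\<in>{}. p x \<noteq> (0::real)} = topspace (powertop_real I)"
      by (simp add: topspace_product_topology)
    then show ?case by (simp only: closure_of_topspace openin_topspace simp_thms)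
  next
    case (insert q P)
    define V where "V = {x \<in> I \<rightarrow>\<^sub>E UNIV. \<forall>p\<in>P. p x \<noteq> (0::real)}"
    define W where "W = {x \<in> I \<rightarrow>\<^sub>E UNIV. q x \<noteq> 0}"
    have V: "openin (powertop_real I) V" "powertop_real I closure_of V = topspace (powertop_real I)"
      using insert by (auto simp: V_def)
    have W: "openin (powertop_real I) W" "powertop_real I closure_of W = topspace (powertop_real I)"
      using openin_nonzero_poly[OF I, of q] dense_nonzero_poly[OF I, of q] insert.prems by (auto simp: W_def)
    have "W \<subseteq> powertop_real I closure_of V"
      unfolding V(2) by (rule openin_subset[OF W(1)])
    then have "powertop_real I closure_of (W \<inter> V) = powertop_real I closure_of W"
      using W(1) by (intro closure_of_openin_Int_superset conjI)
    moreover have "{x \<in> I \<rightarrow>\<^sub>E UNIV. \<forall>p\<in>insert q P. p x \<noteq> 0} = W \<inter> V"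
      by (auto simp: V_def W_def)
    ultimately show ?case using V W by (simp add: openin_Int)
  qed
  then show "openin (powertop_real I) U" "powertop_real I closure_of U = topspace (powertop_real I)"
    by (simp_all add: U_def)
qed

lemma semialgebraic_nonzero_polys:
  assumes I: "finite I" and P: "finite P" "P \<subseteq> polys I"
  shows "semialgebraic I {x \<in> I \<rightarrow>\<^sub>E UNIV. \<forall>p\<in>P. p x \<noteq> 0}"
proof -
  \<comment> \<open>Squaring turns \<open>p x \<noteq> 0\<close> into a strict positivity condition,
    so a single basic set suffices.\<close>
  define Q where "Q = (\<lambda>p x. p x * p x) ` P"
  have "Q \<subseteq> polynomial_funs I"
    using P(2) polys_mult[OF I] polys_subset_polynomial_funs[OF I] by (fastforce simp: Q_def)
  moreover have "finite Q" using P by (simp add: Q_def)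
  moreover have "{x \<in> I \<rightarrow>\<^sub>E UNIV. \<forall>p\<in>P. p x \<noteq> 0} = {x \<in> I \<rightarrow>\<^sub>E UNIV. (\<forall>p\<in>{}. p x = (0::real)) \<and> (\<forall>q\<in>Q. q x > 0)}"
    by (auto simp: Q_def zero_less_mult_iff linorder_neq_iff)
  ultimately have "basic_semialgebraic I {x \<in> I \<rightarrow>\<^sub>E UNIV. \<forall>p\<in>P. p x \<noteq> 0}"
    unfolding basic_semialgebraic_def by (intro exI[of _ "{}"] exI[of _ Q]) auto
  then show ?thesis
    unfolding semialgebraic_def by (intro exI[of _ "{{x \<in> I \<rightarrow>\<^sub>E UNIV. \<forall>p\<in>P. p x \<noteq> 0}}"]) auto
qed

section \<open>Slopes at infinity\<close>

lemma poly_comp_has_derivative: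
  fixes x :: "real ^ 'n"
  shows "(poly_comp d u i has_derivative (\<lambda>h. poly_grad d u i x \<bullet> h)) (at x)"
proof -
  have mon: "((\<lambda>x. monomial_fun UNIV \<alpha> (\<lambda>k. x $ k)) has_derivative
      (\<lambda>h. \<Sum>l\<in>UNIV. monomial_partial l \<alpha> x * h $ l)) (at x)" for \<alpha> :: "'n \<Rightarrow> nat"
  proof -
    have "((\<lambda>x. x $ l ^ \<alpha> l) has_derivative (\<lambda>h. real (\<alpha> l) * h $ l * x $ l ^ (\<alpha> l - 1))) (at x)" for l
      by (rule has_derivative_power) (rule bounded_linear_imp_has_derivative[OF bounded_linear_vec_nth])
    then have "((\<lambda>x. \<Prod>l\<in>UNIV. x $ l ^ \<alpha> l) has_derivative
        (\<lambda>h. \<Sum>l\<in>UNIV. (real (\<alpha> l) * h $ l * x $ l ^ (\<alpha> l - 1)) * (\<Prod>k\<in>UNIV - {l}. x $ k ^ \<alpha> k))) (at x)"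
      by (rule has_derivative_prod)
    then show ?thesis by (simp add: monomial_fun_def monomial_partial_def mult_ac)
  qed
  have "((\<lambda>x. \<Sum>\<alpha>\<in>multi_indices d. u (i, \<alpha>) * monomial_fun UNIV \<alpha> (\<lambda>k. x $ k)) has_derivative
      (\<lambda>h. \<Sum>\<alpha>\<in>multi_indices d. u (i, \<alpha>) * (\<Sum>l\<in>UNIV. monomial_partial l \<alpha> x * h $ l))) (at x)"
    by (intro has_derivative_sum has_derivative_mult_right mon)
  moreover have "(\<Sum>\<alpha>\<in>multi_indices d. u (i, \<alpha>) * (\<Sum>l\<in>UNIV. monomial_partial l \<alpha> x * h $ l))
      = poly_grad d u i x \<bullet> h" for h
    unfolding poly_grad_def inner_vec_def
    by (simp add: sum_distrib_left sum_distrib_right mult.assoc) (rule sum.swap)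
  ultimately show ?thesis by (simp add: poly_comp_def[abs_def])
qed

text \<open>Joint continuity in the scale and the point, with scale 0 included, is what makes
  infinity accessible to a compactness argument.\<close>

lemma continuous_on_rescaled_poly:
  fixes S :: "'b::topological_space set" and w :: "'b \<Rightarrow> real ^ 'n"
  assumes "continuous_on S \<tau>" "continuous_on S w"
  shows "continuous_on S (\<lambda>p. poly_comp d (rescale d (\<tau> p) u) i (w p))"
    and "continuous_on S (\<lambda>p. poly_grad d (rescale d (\<tau> p) u) i (w p))"
  unfolding poly_comp_def poly_grad_def rescale_def monomial_fun_def monomial_partial_def
  using assms by (auto intro!: continuous_intros)

lemma rescale_1: "rescale d 1 u = u"
  by (auto simp: rescale_def)

lemma monomial_scale:
  "monomial_fun UNIV \<alpha> (\<lambda>k. (s *\<^sub>R w) $ k) = s ^ (\<Sum>k\<in>UNIV. \<alpha> k) * monomial_fun UNIV \<alpha> (\<lambda>k. w $ k)"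
  by (simp add: monomial_fun_def power_mult_distrib prod.distrib power_sum)

lemma monomial_partial_scale:
  fixes w :: "real ^ 'n"
  shows "monomial_partial l \<alpha> (s *\<^sub>R w) = s ^ ((\<Sum>k\<in>UNIV. \<alpha> k) - 1) * monomial_partial l \<alpha> w"
proof (cases "\<alpha> l = 0")
  case False
  have "(\<Prod>k\<in>UNIV - {l}. s ^ \<alpha> k) = s ^ (\<Sum>k\<in>UNIV - {l}. \<alpha> k)" by (simp add: power_sum)
  moreover have "(\<Sum>k\<in>UNIV. \<alpha> k) - 1 = (\<alpha> l - 1) + (\<Sum>k\<in>UNIV - {l}. \<alpha> k)"
    using False by (simp add: sum.remove[of UNIV l \<alpha>])
  ultimately show ?thesis
    by (simp add: monomial_partial_def power_mult_distrib prod.distrib power_add)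
qed (simp add: monomial_partial_def)

lemma monomial_partial_degree_0: "(\<Sum>k\<in>UNIV. \<alpha> k) = 0 \<Longrightarrow> monomial_partial l \<alpha> w = 0"
  by (simp add: monomial_partial_def)

text \<open>Used twice: \<open>\<tau> = 1\<close> with \<open>s = norm x\<close> moves a point to
  the unit sphere, and \<open>\<tau> = 0\<close> gives homogeneity of the leading form.\<close>

lemma poly_comp_scale:
  assumes "s \<noteq> 0"
  shows "poly_comp d (rescale d \<tau> u) i (s *\<^sub>R w) = s ^ d * poly_comp d (rescale d (\<tau> / s) u) i w"
  unfolding poly_comp_def sum_distrib_left
proof (rule sum.cong[OF refl])
  fix \<alpha> :: "'a \<Rightarrow> nat" assume "\<alpha> \<in> multi_indices d"
  define e where "e = (\<Sum>k\<in>UNIV. \<alpha> k)"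
  have "e \<le> d" using \<open>\<alpha> \<in> multi_indices d\<close> by (simp add: e_def multi_indices_def)
  then have "s ^ d = s ^ e * s ^ (d - e)" by (simp flip: power_add)
  then show "rescale d \<tau> u (i, \<alpha>) * monomial_fun UNIV \<alpha> (\<lambda>k. (s *\<^sub>R w) $ k)
      = s ^ d * (rescale d (\<tau> / s) u (i, \<alpha>) * monomial_fun UNIV \<alpha> (\<lambda>k. w $ k))"
    using assms unfolding monomial_scale by (simp add: rescale_def power_divide flip: e_def)
qed

lemma poly_grad_scale:
  assumes "s \<noteq> 0"
  shows "poly_grad d (rescale d \<tau> u) i (s *\<^sub>R w) = s ^ (d - 1) *\<^sub>R poly_grad d (rescale d (\<tau> / s) u) i w"
proof -
  have "rescale d \<tau> u (i, \<alpha>) * monomial_partial l \<alpha> (s *\<^sub>R w)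
      = s ^ (d - 1) * (rescale d (\<tau> / s) u (i, \<alpha>) * monomial_partial l \<alpha> w)"
    if \<alpha>: "\<alpha> \<in> multi_indices d" for l \<alpha>
  \<comment> \<open>For degree 0 the truncated exponents do not add up, but both sides
    vanish.\<close>
  proof (cases "(\<Sum>k\<in>UNIV. \<alpha> k) = 0")
    case False
    define e where "e = (\<Sum>k\<in>UNIV. \<alpha> k)"
    have "e \<le> d" "e > 0" using \<alpha> False by (simp_all only: e_def multi_indices_def mem_Collect_eq neq0_conv)
    then have "s ^ (d - 1) = s ^ (e - 1) * s ^ (d - e)" by (simp flip: power_add)
    then show ?thesis
      using assms unfolding monomial_partial_scale by (simp add: rescale_def power_divide flip: e_def)
  qed (simp add: monomial_partial_degree_0)
  then show ?thesis
    by (simp add: poly_grad_def vec_eq_iff sum_distrib_left)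
qed

lemma euler_identity:
  fixes w :: "real ^ 'n"
  shows "w \<bullet> poly_grad d (rescale d 0 u) i w = real d * poly_comp d (rescale d 0 u) i w"
proof -
  have mon: "w $ l * monomial_partial l \<alpha> w = real (\<alpha> l) * monomial_fun UNIV \<alpha> (\<lambda>k. w $ k)"
    for l and \<alpha> :: "'n \<Rightarrow> nat"
    by (cases "\<alpha> l")
      (simp_all add: monomial_partial_def monomial_fun_def prod.remove[of UNIV l] mult_ac)
  have "w \<bullet> poly_grad d (rescale d 0 u) i w
      = (\<Sum>l\<in>UNIV. \<Sum>\<alpha>\<in>top_indices d. u (i, \<alpha>) * (w $ l * monomial_partial l \<alpha> w))"
    unfolding inner_vec_def poly_grad_def vec_lambda_beta sum_rescale_0
    by (simp add: sum_distrib_left mult_ac)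
  also have "\<dots> = (\<Sum>\<alpha>\<in>top_indices d. \<Sum>l\<in>UNIV. u (i, \<alpha>) * (w $ l * monomial_partial l \<alpha> w))"
    by (rule sum.swap)
  also have "\<dots> = (\<Sum>\<alpha>\<in>top_indices d. real d * (u (i, \<alpha>) * monomial_fun UNIV \<alpha> (\<lambda>k. w $ k)))"
  proof (rule sum.cong[OF refl])
    fix \<alpha> :: "'n \<Rightarrow> nat" assume \<alpha>: "\<alpha> \<in> top_indices d"
    have "(\<Sum>l\<in>UNIV. u (i, \<alpha>) * (w $ l * monomial_partial l \<alpha> w))
        = u (i, \<alpha>) * monomial_fun UNIV \<alpha> (\<lambda>k. w $ k) * (\<Sum>l\<in>UNIV. real (\<alpha> l))"
      by (simp add: mon sum_distrib_left mult_ac)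
    also have "(\<Sum>l\<in>UNIV. real (\<alpha> l)) = real d"
      using \<alpha> by (simp add: top_indices_def flip: of_nat_sum)
    finally show "(\<Sum>l\<in>UNIV. u (i, \<alpha>) * (w $ l * monomial_partial l \<alpha> w))
        = real d * (u (i, \<alpha>) * monomial_fun UNIV \<alpha> (\<lambda>k. w $ k))" by simp
  qed
  finally show ?thesis by (simp add: poly_comp_def sum_rescale_0 sum_distrib_left)
qed

text \<open>The coefficients \<open>lam\<close> may have any sign, although only convex ones arise
  later: the excluded set has to be captured by polynomial equations, which ignore signs.\<close>

definition nondegenerate :: "nat \<Rightarrow> nat \<Rightarrow> (nat \<times> ('n::finite \<Rightarrow> nat) \<Rightarrow> real) \<Rightarrow> bool" where
  "nondegenerate r d u \<longleftrightarrow> (\<forall>I lam. \<forall>w :: real ^ 'n. I \<subseteq> {1..r} \<longrightarrow> w \<noteq> 0 \<longrightarrow>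
     (\<forall>i\<in>I. poly_comp d (rescale d 0 u) i w = 0) \<longrightarrow>
     (\<Sum>i\<in>I. lam i *\<^sub>R poly_grad d (rescale d 0 u) i w) = 0 \<longrightarrow> (\<forall>i\<in>I. lam i = 0))"

text \<open>Homogeneity allows dividing \<open>w\<close> by a nonzero coordinate
  \<open>w $ j\<close> and \<open>lam\<close> by a nonzero \<open>lam i0\<close>. This leaves
  finitely many cases \<open>((I, i0), j)\<close>, each with its own hypersurface.\<close>

lemma generic_nondegenerate:
  assumes d: "d > 0"
  obtains P :: "((nat \<times> ('n::finite \<Rightarrow> nat) \<Rightarrow> real) \<Rightarrow> real) set"
  where "finite P" "P \<subseteq> nonzero_polys (coeff_index r d)"
    and "\<And>u. \<forall>p\<in>P. p u \<noteq> 0 \<Longrightarrow> nondegenerate r d u"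
proof -
  define T where "T = Sigma (Pow {1..r}) (\<lambda>I. I) \<times> (UNIV :: 'n set)"
  have "finite T"
    unfolding T_def by (intro finite_cartesian_product finite_SigmaI) (auto intro: finite_subset)
  define vanishes where "vanishes p I i0 j \<longleftrightarrow> (\<forall>u w \<mu>. w $ j = 1 \<longrightarrow> \<mu> i0 = 1 \<longrightarrow>
      (\<forall>i\<in>I. poly_comp d (rescale d 0 u) i w = 0) \<longrightarrow>
      (\<Sum>i\<in>I. \<mu> i *\<^sub>R poly_grad d (rescale d 0 u) i w) = 0 \<longrightarrow> p u = 0)"
    for p :: "(nat \<times> ('n \<Rightarrow> nat) \<Rightarrow> real) \<Rightarrow> real" and I :: "nat set" and i0 j
  have "\<exists>p\<in>nonzero_polys (coeff_index r d). vanishes p I i0 j"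
    if I: "I \<subseteq> {1..r}" "i0 \<in> I" for I i0 and j :: 'n
  proof (rule degenerate_coeffs_in_hypersurface[OF d I, of j])
    fix a D
    assume a: "\<exists>m\<in>coeff_index r d \<rightarrow>\<^sub>E {..D}. a m \<noteq> 0"
      and a0: "\<And>u w \<mu>. w $ j = 1 \<Longrightarrow> \<mu> i0 = 1 \<Longrightarrow>
        (\<And>i. i \<in> I \<Longrightarrow> poly_comp d (rescale d 0 u) i w = 0) \<Longrightarrow>
        (\<Sum>i\<in>I. \<mu> i *\<^sub>R poly_grad d (rescale d 0 u) i w) = 0 \<Longrightarrow>
        (\<Sum>m\<in>coeff_index r d \<rightarrow>\<^sub>E {..D}. a m * monomial_fun (coeff_index r d :: (nat \<times> ('n \<Rightarrow> nat)) set) m u) = 0"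
    show ?thesis
    proof
      show "vanishes (\<lambda>u. \<Sum>m\<in>coeff_index r d \<rightarrow>\<^sub>E {..D}. a m * monomial_fun (coeff_index r d) m u) I i0 j"
        unfolding vanishes_def using a0 by simp
    qed (use a in \<open>auto simp: nonzero_polys_def\<close>)
  qed
  then have ex: "\<exists>p. p \<in> nonzero_polys (coeff_index r d) \<and> vanishes p I i0 j"
    if "((I, i0), j) \<in> T" for I i0 j
    using that unfolding T_def by blast
  define q where "q = (\<lambda>((I, i0), j). SOME p. p \<in> nonzero_polys (coeff_index r d) \<and> vanishes p I i0 j)"
  have q: "q ((I, i0), j) \<in> nonzero_polys (coeff_index r d)" "vanishes (q ((I, i0), j)) I i0 j"
    if "((I, i0), j) \<in> T" for I i0 j
    using someI_ex[OF ex[OF that]] by (simp_all add: q_def)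
  show thesis
  proof (rule that[of "q ` T"])
    show "finite (q ` T)" using \<open>finite T\<close> by simp
    show "q ` T \<subseteq> nonzero_polys (coeff_index r d)" using q(1) by auto
    fix u assume nz: "\<forall>p\<in>q ` T. p u \<noteq> 0"
    show "nondegenerate r d u"
      unfolding nondegenerate_def
    proof (intro allI impI ballI, rule ccontr)
      fix I i0 and lam :: "nat \<Rightarrow> real" and w :: "real ^ 'n"
      assume I: "I \<subseteq> {1..r}" "i0 \<in> I" and w: "w \<noteq> 0" and lam: "lam i0 \<noteq> 0"
        and p0: "\<forall>i\<in>I. poly_comp d (rescale d 0 u) i w = 0"
        and grad0: "(\<Sum>i\<in>I. lam i *\<^sub>R poly_grad d (rescale d 0 u) i w) = 0"
      obtain j where j: "w $ j \<noteq> 0" using w by (auto simp: vec_eq_iff)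
      define s where "s = 1 / w $ j"
      have s: "s \<noteq> 0" using j by (simp add: s_def)
      have t: "((I, i0), j) \<in> T" using I by (auto simp: T_def)
      have "(\<Sum>i\<in>I. (lam i / lam i0) *\<^sub>R poly_grad d (rescale d 0 u) i (s *\<^sub>R w))
          = (s ^ (d - 1) / lam i0) *\<^sub>R (\<Sum>i\<in>I. lam i *\<^sub>R poly_grad d (rescale d 0 u) i w)"
        unfolding poly_grad_scale[OF s] by (simp add: scaleR_sum_right mult.commute)
      then have "(\<Sum>i\<in>I. (lam i / lam i0) *\<^sub>R poly_grad d (rescale d 0 u) i (s *\<^sub>R w)) = 0"
        by (simp add: grad0)
      moreover have "\<forall>i\<in>I. poly_comp d (rescale d 0 u) i (s *\<^sub>R w) = 0"
        using p0 by (simp add: poly_comp_scale[OF s])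
      moreover have "(s *\<^sub>R w) $ j = 1" using j by (simp add: s_def)
      ultimately have "q ((I, i0), j) u = 0"
        using q(2)[OF t, unfolded vanishes_def, THEN spec[of _ u], THEN spec[of _ "s *\<^sub>R w"],
            THEN spec[of _ "\<lambda>i. lam i / lam i0"]] lam by simp
      with nz t show False by auto
    qed
  qed
qed

text \<open>The summand \<open>\<tau>\<close> makes the function to be bounded positive on the whole compact parameter
  space, not just on the slice \<open>\<tau> = 0\<close>, so that its minimum can serve as \<open>c\<close>.\<close>

definition rescaled_gradient_bound ::
    "nat \<Rightarrow> (nat \<times> ('n::finite \<Rightarrow> nat) \<Rightarrow> real) \<Rightarrow> nat set \<Rightarrow> real \<Rightarrow> bool" where
  "rescaled_gradient_bound d u I c \<longleftrightarrow> (\<forall>\<tau>\<in>{0..1}. \<forall>lam\<in>UNIV \<rightarrow> {0..1}. \<forall>w\<in>sphere (0 :: real ^ 'n) 1.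
     sum lam I = 1 \<longrightarrow>
     (\<forall>i\<in>I. \<forall>k\<in>I. poly_comp d (rescale d \<tau> u) i w = poly_comp d (rescale d \<tau> u) k w) \<longrightarrow>
     c \<le> norm (\<Sum>i\<in>I. lam i *\<^sub>R poly_grad d (rescale d \<tau> u) i w) + \<tau>)"

text \<open>The minimum of \<open>h\<close> over a compact set is attained. If it were 0, then
  \<open>\<tau> = 0\<close>, and Euler's identity would yield a dependence at a common zero, against
  \<open>nd\<close>.\<close>

lemma ex_rescaled_gradient_bound:
  fixes u :: "nat \<times> ('n::finite \<Rightarrow> nat) \<Rightarrow> real"
  assumes nd: "nondegenerate r d u" and d: "d > 0" and I: "I \<subseteq> {1..r}"
  shows "\<exists>c>0. rescaled_gradient_bound d u I c"
proof -
  define f where "f \<tau> w i = poly_comp d (rescale d \<tau> u) i w" for \<tau> and w :: "real ^ 'n" and i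
  define G where "G \<tau> w i = poly_grad d (rescale d \<tau> u) i w" for \<tau> and w :: "real ^ 'n" and i
  \<comment> \<open>The constraints on values and weights enter as penalty terms, so that the domain
    \<open>K\<close> is a plain product of compact sets.\<close>
  define h where "h = (\<lambda>(\<tau>, w, lam). norm (\<Sum>i\<in>I. lam i *\<^sub>R G \<tau> w i)
      + (\<Sum>i\<in>I. \<Sum>k\<in>I. \<bar>f \<tau> w i - f \<tau> w k\<bar>) + \<bar>sum lam I - 1\<bar> + \<tau>)"
  define K where "K = {0..1::real} \<times> (sphere 0 1 :: (real ^ 'n) set) \<times> (UNIV \<rightarrow>\<^sub>E {0..1::real} :: (nat \<Rightarrow> real) set)"
  have "finite I" using I finite_subset by blast
  have "compact (UNIV \<rightarrow>\<^sub>E {0..1::real} :: (nat \<Rightarrow> real) set)"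
    using compactin_PiE[of "\<lambda>_. euclideanreal" "UNIV :: nat set" "\<lambda>_. {0..1}"]
    by (simp add: euclidean_product_topology)
  then have "compact K" unfolding K_def by (intro compact_Times compact_Icc compact_sphere)
  moreover have "K \<noteq> {}"
    using vector_choose_size[of 1, where 'a = "real ^ 'n"] by (auto simp: K_def PiE_eq_empty_iff)
  moreover have "continuous_on K h"
  proof -
    have coord: "continuous_on K (\<lambda>p. snd (snd p) i)" for i
      by (rule continuous_on_compose2[OF continuous_on_product_coordinates[of i], of K "\<lambda>p. snd (snd p)"])
        (intro continuous_intros, simp)
    show ?thesis
      unfolding h_def case_prod_unfold f_def G_def
      by (intro continuous_intros continuous_on_rescaled_poly coord)
  qed
  ultimately obtain p where p: "p \<in> K" "\<And>q. q \<in> K \<Longrightarrow> h p \<le> h q"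
    using continuous_attains_inf[of K h] by blast
  obtain \<tau> w lam where p_eq: "p = (\<tau>, w, lam)" by (cases p)
  have \<tau>: "0 \<le> \<tau>" and w: "norm w = 1" using p(1) by (auto simp: p_eq K_def)
  have parts: "0 \<le> norm (\<Sum>i\<in>I. lam i *\<^sub>R G \<tau> w i)" "0 \<le> (\<Sum>i\<in>I. \<Sum>k\<in>I. \<bar>f \<tau> w i - f \<tau> w k\<bar>)"
    "0 \<le> \<bar>sum lam I - 1\<bar>"
    by (simp_all add: sum_nonneg)
  have "h p \<noteq> 0"
  proof
    assume "h p = 0"
    then have sum0: "norm (\<Sum>i\<in>I. lam i *\<^sub>R G \<tau> w i) + (\<Sum>i\<in>I. \<Sum>k\<in>I. \<bar>f \<tau> w i - f \<tau> w k\<bar>)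
        + \<bar>sum lam I - 1\<bar> + \<tau> = 0"
      by (simp only: h_def p_eq prod.case)
    have "\<tau> = 0" using sum0 parts \<tau> by linarith
    have "norm (\<Sum>i\<in>I. lam i *\<^sub>R G \<tau> w i) = 0" using sum0 parts \<tau> by linarith
    then have grad0: "(\<Sum>i\<in>I. lam i *\<^sub>R G \<tau> w i) = 0" by simp
    have "\<bar>sum lam I - 1\<bar> = 0" using sum0 parts \<tau> by linarith
    then have lam: "sum lam I = 1" by simp
    have diff0: "(\<Sum>i\<in>I. \<Sum>k\<in>I. \<bar>f \<tau> w i - f \<tau> w k\<bar>) = 0" using sum0 parts \<tau> by linarith
    have eq: "f 0 w i = f 0 w k" if ik: "i \<in> I" "k \<in> I" for i k
    proof -
      have "(\<Sum>k\<in>I. \<bar>f \<tau> w i - f \<tau> w k\<bar>) = 0"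
        by (rule sum_nonneg_0[OF \<open>finite I\<close> _ diff0 ik(1)]) (simp add: sum_nonneg)
      from sum_nonneg_0[OF \<open>finite I\<close> _ this ik(2)] show ?thesis
        by (simp add: \<open>\<tau> = 0\<close>)
    qed
    have "I \<noteq> {}" using lam by auto
    then obtain i0 where i0: "i0 \<in> I" by auto
    \<comment> \<open>Since all \<open>f 0 w i\<close> agree and the weights sum to 1, Euler's
      identity isolates the common value.\<close>
    have "0 = w \<bullet> (\<Sum>i\<in>I. lam i *\<^sub>R G \<tau> w i)" using grad0 by simp
    also have "\<dots> = (\<Sum>i\<in>I. lam i * (real d * f 0 w i))"
      unfolding \<open>\<tau> = 0\<close> by (simp add: inner_sum_right G_def f_def euler_identity)
    also have "\<dots> = (\<Sum>i\<in>I. lam i * (real d * f 0 w i0))"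
      by (intro sum.cong refl) (simp add: eq[OF _ i0])
    also have "\<dots> = real d * f 0 w i0" using lam by (simp flip: sum_distrib_right)
    finally have "f 0 w i0 = 0" using d by simp
    then have "\<forall>i\<in>I. f 0 w i = 0" using eq i0 by metis
    moreover have "w \<noteq> 0" using w by auto
    ultimately have "\<forall>i\<in>I. lam i = 0"
      using nd[unfolded nondegenerate_def, rule_format, OF I, of w lam] grad0
      by (auto simp: f_def G_def \<open>\<tau> = 0\<close>)
    with lam show False by simp
  qed
  moreover have "h p \<ge> 0" using parts \<tau> by (simp add: h_def p_eq)
  ultimately have pos: "h p > 0" by simp
  have "rescaled_gradient_bound d u I (h p)"
    unfolding rescaled_gradient_bound_def
  proof (intro ballI impI)
    fix \<tau>' and lam' :: "nat \<Rightarrow> real" and w' :: "real ^ 'n"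
    assume *: "\<tau>' \<in> {0..1}" "lam' \<in> UNIV \<rightarrow> {0..1}" "w' \<in> sphere 0 1" "sum lam' I = 1"
      and eq: "\<forall>i\<in>I. \<forall>k\<in>I. poly_comp d (rescale d \<tau>' u) i w' = poly_comp d (rescale d \<tau>' u) k w'"
    have "\<bar>f \<tau>' w' i - f \<tau>' w' k\<bar> = 0" if "i \<in> I" "k \<in> I" for i k
      unfolding f_def bspec[OF bspec[OF eq that(1)] that(2)] by simp
    then have "(\<Sum>i\<in>I. \<Sum>k\<in>I. \<bar>f \<tau>' w' i - f \<tau>' w' k\<bar>) = 0"
      by (intro sum.neutral ballI)
    moreover have "(\<tau>', w', lam') \<in> K" using * by (simp add: K_def PiE_UNIV_domain Pi_def)
    ultimately show "h p \<le> norm (\<Sum>i\<in>I. lam' i *\<^sub>R poly_grad d (rescale d \<tau>' u) i w') + \<tau>'"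
      using p(2)[of "(\<tau>', w', lam')"] *(4) by (simp add: h_def G_def)
  qed
  with pos show ?thesis by blast
qed

lemma gradient_bound_at_infinity:
  fixes u :: "nat \<times> ('n::finite \<Rightarrow> nat) \<Rightarrow> real"
  assumes nd: "nondegenerate r d u" and d: "d > 0"
  obtains c R where "c > 0" "R > 0"
    and "\<And>(x :: real ^ 'n) I lam. norm x \<ge> R \<Longrightarrow> I \<subseteq> {1..r} \<Longrightarrow>
      (\<And>i k. i \<in> I \<Longrightarrow> k \<in> I \<Longrightarrow> poly_comp d u i x = poly_comp d u k x) \<Longrightarrow>
      (\<And>i. i \<in> I \<Longrightarrow> 0 \<le> lam i) \<Longrightarrow> sum lam I = 1 \<Longrightarrow>
      norm (\<Sum>i\<in>I. lam i *\<^sub>R poly_grad d u i x) \<ge> c"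
proof -
  have "\<forall>I\<in>Pow {1..r}. \<exists>c. c > 0 \<and> rescaled_gradient_bound d u I c"
    using ex_rescaled_gradient_bound[OF nd d] by simp
  from bchoice[OF this] obtain C
    where C: "\<And>I. I \<in> Pow {1..r} \<Longrightarrow> C I > 0" "\<And>I. I \<in> Pow {1..r} \<Longrightarrow> rescaled_gradient_bound d u I (C I)"
    by auto
  define c where "c = Min (C ` Pow {1..r})"
  have "c > 0" unfolding c_def by (subst Min_gr_iff) (use C(1) in auto)
  have c_le: "c \<le> C I" if "I \<subseteq> {1..r}" for I
    unfolding c_def using that by (intro Min_le) auto
  \<comment> \<open>\<open>norm x \<ge> 2 / c\<close> makes \<open>\<tau> \<le> c / 2\<close>, so
    dropping the summand \<open>\<tau>\<close> costs half of the bound;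
    \<open>norm x \<ge> 1\<close> gives \<open>\<tau> \<le> 1\<close> and
    \<open>s ^ (d - 1) \<ge> 1\<close>.\<close>
  define R where "R = max 1 (2 / c)"
  show thesis
  proof (rule that[of "c / 2" R])
    show "c / 2 > 0" "R > 0" using \<open>c > 0\<close> by (auto simp: R_def)
    fix x :: "real ^ 'n" and I and lam :: "nat \<Rightarrow> real"
    assume x: "R \<le> norm x" and I: "I \<subseteq> {1..r}"
      and eq: "\<And>i k. i \<in> I \<Longrightarrow> k \<in> I \<Longrightarrow> poly_comp d u i x = poly_comp d u k x"
      and lam: "\<And>i. i \<in> I \<Longrightarrow> 0 \<le> lam i" "sum lam I = 1"
    have "finite I" using I finite_subset by blast
    define s where "s = norm x"
    define w where "w = (1 / s) *\<^sub>R x"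
    define \<tau> where "\<tau> = 1 / s"
    have s: "s \<ge> 1" "s \<ge> 2 / c" using x by (auto simp: s_def R_def)
    have \<tau>: "\<tau> \<in> {0..1}" using s(1) by (simp add: \<tau>_def)
    have "2 \<le> s * c" using s(2) \<open>c > 0\<close> by (simp add: pos_divide_le_eq)
    then have \<tau>_le: "\<tau> \<le> c / 2" using s(1) by (simp add: \<tau>_def field_simps)
    have x_eq: "x = s *\<^sub>R w" using s(1) by (simp add: w_def)
    have w: "norm w = 1" using s(1) by (auto simp: w_def s_def)
    have comp: "poly_comp d u i x = s ^ d * poly_comp d (rescale d \<tau> u) i w" for i
      using poly_comp_scale[of s d 1 u i w] s(1) by (simp add: x_eq rescale_1 \<tau>_def)
    have grad: "poly_grad d u i x = s ^ (d - 1) *\<^sub>R poly_grad d (rescale d \<tau> u) i w" for i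
      using poly_grad_scale[of s d 1 u i w] s(1) by (simp add: x_eq rescale_1 \<tau>_def)
    \<comment> \<open>The compact parameter space has weights on all of the naturals, so
      \<open>lam\<close> is extended by 0 outside \<open>I\<close>.\<close>
    define lam' where "lam' i = (if i \<in> I then lam i else 0)" for i
    have "lam i \<le> 1" if "i \<in> I" for i
      using member_le_sum[of i I lam] that lam \<open>finite I\<close> by auto
    then have lam': "lam' i \<in> {0..1}" for i using lam by (simp add: lam'_def)
    have sum_lam': "sum lam' I = 1" using lam(2) by (simp add: lam'_def)
    have "C I \<le> norm (\<Sum>i\<in>I. lam' i *\<^sub>R poly_grad d (rescale d \<tau> u) i w) + \<tau>"
    proof -
      have "poly_comp d (rescale d \<tau> u) i w = poly_comp d (rescale d \<tau> u) k w" if "i \<in> I" "k \<in> I" for i k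
        using eq[OF that] s(1) unfolding comp by simp
      moreover have "lam' \<in> UNIV \<rightarrow> {0..1}" "w \<in> sphere 0 1" "I \<in> Pow {1..r}"
        using lam' w I by auto
      ultimately show ?thesis
        using C(2)[of I, unfolded rescaled_gradient_bound_def] \<tau> sum_lam' by blast
    qed
    then have "c / 2 \<le> norm (\<Sum>i\<in>I. lam i *\<^sub>R poly_grad d (rescale d \<tau> u) i w)"
      using \<tau>_le c_le[OF I] by (simp add: lam'_def)
    also have "\<dots> \<le> s ^ (d - 1) * norm (\<Sum>i\<in>I. lam i *\<^sub>R poly_grad d (rescale d \<tau> u) i w)"
      using mult_right_mono[OF one_le_power[OF s(1), of "d - 1"] norm_ge_zero] by simp
    also have "\<dots> = norm (s ^ (d - 1) *\<^sub>R (\<Sum>i\<in>I. lam i *\<^sub>R poly_grad d (rescale d \<tau> u) i w))"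
      using s(1) by simp
    also have "\<dots> = norm (\<Sum>i\<in>I. lam i *\<^sub>R poly_grad d u i x)"
      by (simp add: grad scaleR_sum_right mult.commute)
    finally show "c / 2 \<le> norm (\<Sum>i\<in>I. lam i *\<^sub>R poly_grad d u i x)" .
  qed
qed

theorem theorem4p4:
  fixes d r :: nat
  assumes "d > 0" and "r > 0"
  shows "\<exists>U :: (nat \<times> ('n::finite \<Rightarrow> nat) \<Rightarrow> real) set.
    openin (powertop_real (coeff_index r d)) U \<and>
    powertop_real (coeff_index r d) closure_of U = topspace (powertop_real (coeff_index r d)) \<and>
    semialgebraic (coeff_index r d) U \<and>
    (\<forall>u\<in>U. \<forall>f\<in>cont_selections r d u.
       (\<exists>c>0. \<exists>R>0. \<forall>x :: real ^ 'n. norm x \<ge> R \<longrightarrow> nonsmooth_slope f x \<ge> ereal c) \<and>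
       (bdd_below (range f) \<longrightarrow>
          (\<exists>c>0. \<exists>R>0. \<forall>x :: real ^ 'n. norm x \<ge> R \<longrightarrow> f x \<ge> c * norm x) \<and>
          coercive f))"
proof -
  let ?A = "coeff_index r d :: (nat \<times> ('n \<Rightarrow> nat)) set"
  have finA: "finite ?A" by (rule finite_coeff_index)
  obtain P where P: "finite P" "P \<subseteq> nonzero_polys ?A"
    and nd: "\<forall>u. (\<forall>p\<in>P. p u \<noteq> 0) \<longrightarrow> nondegenerate r d u"
    using generic_nondegenerate[OF \<open>d > 0\<close>, of r] by metis
  let ?U = "{u \<in> ?A \<rightarrow>\<^sub>E UNIV. \<forall>p\<in>P. p u \<noteq> 0}"
  have "P \<subseteq> polys ?A" using P(2) nonzero_polys_subset by blast
  have "(\<exists>c>0. \<exists>R>0. \<forall>x :: real ^ 'n. norm x \<ge> R \<longrightarrow> nonsmooth_slope f x \<ge> ereal c) \<and>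
      (bdd_below (range f) \<longrightarrow>
        (\<exists>c>0. \<exists>R>0. \<forall>x :: real ^ 'n. norm x \<ge> R \<longrightarrow> f x \<ge> c * norm x) \<and> coercive f)"
    if u: "u \<in> ?U" and f: "f \<in> cont_selections r d u" for u f
  proof (rule gradient_bound_at_infinity[of r d u])
    show "nondegenerate r d u" using u nd by auto
    fix c R :: real
    assume pos: "c > 0" "R > 0" and
      bound: "\<And>(x :: real ^ 'n) I lam. norm x \<ge> R \<Longrightarrow> I \<subseteq> {1..r} \<Longrightarrow>
        (\<And>i k. i \<in> I \<Longrightarrow> k \<in> I \<Longrightarrow> poly_comp d u i x = poly_comp d u k x) \<Longrightarrow>
        (\<And>i. i \<in> I \<Longrightarrow> 0 \<le> lam i) \<Longrightarrow> sum lam I = 1 \<Longrightarrow>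
        norm (\<Sum>i\<in>I. lam i *\<^sub>R poly_grad d u i x) \<ge> c"
    interpret selection_with_gradient_bound "{1..r}" f "poly_comp d u" "poly_grad d u" c R
    proof
      show "continuous_on UNIV f" "f x \<in> (\<lambda>i. poly_comp d u i x) ` {1..r}" for x
        using f by (auto simp: cont_selections_def)
      show "continuous_on UNIV (poly_grad d u i)" for i
        using continuous_on_rescaled_poly(2)[of UNIV "\<lambda>_. 1" "\<lambda>x. x" d u i]
        by (simp add: rescale_1)
      show "c \<le> norm (\<Sum>i\<in>I. lam i *\<^sub>R poly_grad d u i x)"
        if "R \<le> norm x" "I \<subseteq> {1..r}" "\<And>i k. i \<in> I \<Longrightarrow> k \<in> I \<Longrightarrow> poly_comp d u i x = poly_comp d u k x"
          "\<And>i. i \<in> I \<Longrightarrow> 0 \<le> lam i" "sum lam I = 1" for x I lam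
        by (rule bound[OF that])
    qed (rule finite_atLeastAtMost poly_comp_has_derivative pos(1))+
    have "\<exists>c>0. \<exists>R>0. \<forall>x. norm x \<ge> R \<longrightarrow> nonsmooth_slope f x \<ge> ereal c"
      using pos nonsmooth_slope_ge by blast
    moreover have "(\<exists>c>0. \<exists>R>0. \<forall>x. norm x \<ge> R \<longrightarrow> f x \<ge> c * norm x) \<and> coercive f"
      if bdd: "bdd_below (range f)"
    proof (rule linear_growth[OF bdd], rule conjI)
      fix R' assume R': "R' > 0" "\<And>x. norm x \<ge> R' \<Longrightarrow> f x \<ge> c / 4 * norm x"
      have c4: "c / 4 > 0" using pos(1) by simp
      show "coercive f" using c4 R'(2) by (rule coerciveI_linear)
      show "\<exists>c>0. \<exists>R>0. \<forall>x. norm x \<ge> R \<longrightarrow> f x \<ge> c * norm x"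
        using c4 R' by blast
    qed
    ultimately show ?thesis by simp
  qed (fact \<open>d > 0\<close>)
  note slope_and_growth = this
  show ?thesis
    by (intro exI[of _ ?U] conjI open_dense_nonzero_polys[OF finA P]
        semialgebraic_nonzero_polys[OF finA P(1) \<open>P \<subseteq> polys ?A\<close>])
      (intro ballI, rule slope_and_growth)
qed

end
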